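(* Let $n\in\{2,3\}$, let $B_1\subset\mathbb{R}^n$ be the unit ball and $S=\partial B_1$. Let $u$ be the solution of the Cauchy problem $$u_{tt}-\Delta u=0,\quad x\in\mathbb{R}^n,\ t>0,\qquad u|_{t=0}=a(x),\quad u_t|_{t=0}=b(x),$$ where the supports of $a$ and $b$ are located inside $S$. If one of the Cauchy data $a$, $b$ is zero, then we can recover the remaining one using the observation $u|_{S\times(0,1)}$.
   Context: "Recover" means to reconstruct the unknown function from the observation, i.e. from the values of the solution $u(x,t)$ for $x\in S$, $0<t<1$. *)

theory Defs
  imports "HOL-Analysis.Analysis"
begin

definition supp :: "('a::topological_space \<Rightarrow> real) \<Rightarrow> 'a set" where
  "supp f = closure {x. f x \<noteq> 0}"

text \<open>
  The derivative is taken within \<open>D\<close> so that the same definition serves for the open half-space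
  \<open>t > 0\<close> (where it is the ordinary derivative) and for the closed half-space \<open>t \<ge> 0\<close>
  (where the derivative in \<open>t\<close> at \<open>t = 0\<close> is one-sided). On both sets the derivative
  within the set is unique.
\<close>

definition partial_on :: "'a::euclidean_space set \<Rightarrow> 'a \<Rightarrow> ('a \<Rightarrow> real) \<Rightarrow> 'a \<Rightarrow> real" where
  "partial_on D v f p = frechet_derivative f (at p within D) v"

primrec Ck_on :: "nat \<Rightarrow> 'a::euclidean_space set \<Rightarrow> ('a \<Rightarrow> real) \<Rightarrow> bool" where
  "Ck_on 0 D f \<longleftrightarrow> continuous_on D f"
| "Ck_on (Suc k) D f \<longleftrightarrow>
     f differentiable_on D \<and> (\<forall>v\<in>Basis. Ck_on k D (partial_on D v f))"

abbreviation open_half :: "((real^'n) \<times> real) set" where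
  "open_half \<equiv> UNIV \<times> {0<..}"

abbreviation closed_half :: "((real^'n) \<times> real) set" where
  "closed_half \<equiv> UNIV \<times> {0..}"

definition d_tt :: "((real^'n) \<times> real \<Rightarrow> real) \<Rightarrow> (real^'n) \<times> real \<Rightarrow> real" where
  "d_tt u = partial_on open_half (0, 1) (partial_on open_half (0, 1) u)"

definition laplace_x :: "((real^'n) \<times> real \<Rightarrow> real) \<Rightarrow> (real^'n) \<times> real \<Rightarrow> real" where
  "laplace_x u p =
     (\<Sum>i\<in>UNIV. partial_on open_half (axis i 1, 0) (partial_on open_half (axis i 1, 0) u) p)"

text \<open>
  Classical solutions: twice continuously differentiable for \<open>t > 0\<close> and continuously
  differentiable up to \<open>t = 0\<close>.
\<close>

definition solves_wave_cauchy ::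
  "((real^'n) \<times> real \<Rightarrow> real) \<Rightarrow> (real^'n \<Rightarrow> real) \<Rightarrow> (real^'n \<Rightarrow> real) \<Rightarrow> bool" where
  "solves_wave_cauchy u a b \<longleftrightarrow>
     Ck_on 2 open_half u \<and> Ck_on 1 closed_half u \<and>
     (\<forall>x t. t > 0 \<longrightarrow> d_tt u (x, t) - laplace_x u (x, t) = 0) \<and>
     (\<forall>x. u (x, 0) = a x) \<and>
     (\<forall>x. partial_on closed_half (0, 1) u (x, 0) = b x)"

definition observation :: "((real^'n) \<times> real \<Rightarrow> real) \<Rightarrow> (real^'n) \<times> real \<Rightarrow> real" where
  "observation u = restrict u (sphere 0 1 \<times> {0<..<1})"

end

theory Submission
  imports Defs
begin

text \<open>
  By linearity it suffices to treat a solution \<open>u\<close> that vanishes on the sphere for \<open>0 < t < 1\<close>.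
  Its moments \<open>U l (r, t)\<close>, the means of \<open>u (r \<omega>, t)\<close> against the monomials \<open>Y l \<omega>\<close> of a fixed
  degree, satisfy a finite linear system
  \<open>U\<^sub>t\<^sub>t = U\<^sub>r\<^sub>r + ((n - 1) / r) U\<^sub>r + (1 / r\<^sup>2) M U\<close>: the spherical Laplacian is a sum of
  squares of rotation generators, these are antisymmetric under the mean, and they preserve the span
  of the monomials of a given degree.

  For this system \<open>r\<close> and \<open>t\<close> are on an equal footing, so one uniqueness lemma on characteristic
  triangles is used twice. Outside the ball, with \<open>t\<close> as time, the zero initial data and \<open>U = 0\<close> at
  \<open>r = 1\<close> give \<open>U = 0\<close>, hence also \<open>U\<^sub>r = 0\<close> at \<open>r = 1\<close>. Inside the ball, with \<open>1 - r\<close> as time,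
  the zero Cauchy data at \<open>r = 1\<close> and the boundary condition at \<open>t = 0\<close> coming from the vanishing
  datum give \<open>U = 0\<close> for \<open>t < r\<close>. At \<open>t = 0\<close> all moments vanish, and polynomials are dense.
\<close>

subsection \<open>Uniqueness on characteristic triangles\<close>

text \<open>Monomials of one degree replace spherical harmonics: the triangle lemma asks only for a
  bound on the lower-order terms, so a coupled, non-diagonal system serves as well as a scalar
  equation. A solution is C^2 only for t > 0 and C^1 up to t = 0. Hence no second derivative may be
  used at the initial time: the first derivatives U_t + U_r and U_t - U_r are transported along
  characteristics inside the open region, and only continuity is used up to its boundary. The
  observation time equals the radius of the ball because the moments at (r, 0) are reached from the
  Cauchy data on r = 1 for 0 \<le> t \<le> 1 - r, and every r > 0 has to be reached. The radii in
  that triangle are at least r, which keeps 1 / r^2 bounded; the centre follows by continuity. If a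
  = 0 then U_r = 0 at t = 0, and if b = 0 then U_t = 0 there. Either way |U_t + U_r| = |U_t - U_r|,
  a reflection law that lets one argument treat both unknowns.\<close>

lemma exp_increment_bound:
  fixes g :: "real \<Rightarrow> real"
  assumes "a \<le> b" "l > 0" "continuous_on {a..b} g"
    and d: "\<And>h. a < h \<Longrightarrow> h < b \<Longrightarrow> (g has_real_derivative g' h) (at h)"
    and B: "\<And>h. a < h \<Longrightarrow> h < b \<Longrightarrow> \<bar>g' h\<bar> \<le> C * exp (l * h)"
  shows "\<bar>g b - g a\<bar> \<le> C / l * (exp (l * b) - exp (l * a))"
proof (cases "a = b")
  case False
  \<comment> \<open>An antiderivative of the bound. The gained factor \<open>1 / l\<close> is small
    for large \<open>l\<close>; this is the source of the contraction below.\<close>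
  let ?e = "\<lambda>h. C / l * exp (l * h)"
  have "norm (g b - g a) \<le> ?e b - ?e a"
  proof (rule differentiable_bound_general)
    show "(?e has_vector_derivative C * exp (l * h)) (at h)" for h
      using \<open>l > 0\<close> unfolding has_real_derivative_iff_has_vector_derivative[symmetric]
      by (auto intro!: derivative_eq_intros)
    show "continuous_on {a..b} ?e" by (intro continuous_intros)
  qed (use assms False in \<open>auto simp: has_real_derivative_iff_has_vector_derivative\<close>)
  then show ?thesis by (simp add: right_diff_distrib)
qed auto

lemma has_real_derivative_shift_0:
  "((\<lambda>h. f (x + h)) has_real_derivative d) (at 0) \<longleftrightarrow> (f has_real_derivative d) (at x)"
  using DERIV_shift[of f d 0 x] by (simp add: add.commute)

text \<open>\<open>Us + Uy\<close> is transported along s + y = const and \<open>Us - Uy\<close>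
  along y - s = const, both with rate \<open>F\<close>, which for a C^2 function is U_ss - U_yy. For
  large \<open>l\<close>, a joint bound with weight \<open>exp (l * s)\<close> implies the same
  bound halved, and iteration forces zero. The condition \<open>bdry\<close> says that
  \<open>Us\<close> or \<open>Uy\<close> vanishes at y = 0, so it covers Dirichlet and Neumann
  conditions at once.\<close>

lemma characteristic_triangle_zero:
  fixes U Us Uy F :: "'i \<Rightarrow> real \<times> real \<Rightarrow> real" and c K :: real
  defines "T \<equiv> {(s, y). 0 \<le> s \<and> 0 \<le> y \<and> s + y \<le> c}"
  assumes A: "finite A"
    and cont: "\<And>i. i \<in> A \<Longrightarrow> continuous_on T (U i)" "\<And>i. i \<in> A \<Longrightarrow> continuous_on T (Us i)"
      "\<And>i. i \<in> A \<Longrightarrow> continuous_on T (Uy i)"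
    and init: "\<And>i y. i \<in> A \<Longrightarrow> 0 \<le> y \<Longrightarrow> y \<le> c \<Longrightarrow> U i (0, y) = 0 \<and> Us i (0, y) = 0 \<and> Uy i (0, y) = 0"
    and bdry: "\<And>i s. i \<in> A \<Longrightarrow> 0 < s \<Longrightarrow> s \<le> c \<Longrightarrow>
      \<bar>Us i (s, 0) + Uy i (s, 0)\<bar> = \<bar>Us i (s, 0) - Uy i (s, 0)\<bar>"
    and dU: "\<And>i s y. i \<in> A \<Longrightarrow> 0 < s \<Longrightarrow> 0 < y \<Longrightarrow> s + y \<le> c \<Longrightarrow>
      ((\<lambda>h. U i (s + h, y - h)) has_real_derivative Us i (s, y) - Uy i (s, y)) (at 0)"
    and dP: "\<And>i s y. i \<in> A \<Longrightarrow> 0 < s \<Longrightarrow> 0 < y \<Longrightarrow> s + y \<le> c \<Longrightarrow>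
      ((\<lambda>h. Us i (s + h, y - h) + Uy i (s + h, y - h)) has_real_derivative F i (s, y)) (at 0)"
    and dQ: "\<And>i s y. i \<in> A \<Longrightarrow> 0 < s \<Longrightarrow> 0 < y \<Longrightarrow> s + y \<le> c \<Longrightarrow>
      ((\<lambda>h. Us i (s + h, y + h) - Uy i (s + h, y + h)) has_real_derivative F i (s, y)) (at 0)"
    and F: "\<And>i s y. i \<in> A \<Longrightarrow> 0 < s \<Longrightarrow> 0 < y \<Longrightarrow> s + y \<le> c \<Longrightarrow>
      \<bar>F i (s, y)\<bar> \<le> K * (\<Sum>j\<in>A. \<bar>U j (s, y)\<bar> + \<bar>Us j (s, y)\<bar> + \<bar>Uy j (s, y)\<bar>)"
    and i: "i \<in> A" and T: "(s, y) \<in> T"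
  shows "U i (s, y) = 0" "Us i (s, y) = 0" "Uy i (s, y) = 0"
proof -
  let ?P = "\<lambda>i z. Us i z + Uy i z" and ?Q = "\<lambda>i z. Us i z - Uy i z"
  \<comment> \<open>The 3 counts \<open>U\<close>, \<open>Us\<close> and \<open>Uy\<close> for each
    of the \<open>card A\<close> indices. The added 1 gives \<open>K' \<ge> 1\<close>, so that the
    constant also covers the equation for \<open>U\<close>, whose rate is \<open>Us - Uy\<close>.
    With \<open>l = 4 * K'\<close>, integrating a rate \<open>K' * B\<close> along a characteristic
    yields \<open>B / 4\<close>.\<close>
  define K' where "K' = 3 * \<bar>K\<bar> * card A + 1"
  define l where "l = 4 * K'"
  have K': "K' \<ge> 1" by (simp add: K'_def)
  then have l: "l > 0" by (simp add: l_def)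
  define bd where "bd B \<longleftrightarrow> (\<forall>i\<in>A. \<forall>s y. (s, y) \<in> T \<longrightarrow> \<bar>U i (s, y)\<bar> \<le> B * exp (l * s)
      \<and> \<bar>?P i (s, y)\<bar> \<le> B * exp (l * s) \<and> \<bar>?Q i (s, y)\<bar> \<le> B * exp (l * s))" for B
  have line: "continuous_on {a..b} (\<lambda>h. g (p + h * e, q + h * f))"
    if "continuous_on T g" "\<And>h. a \<le> h \<Longrightarrow> h \<le> b \<Longrightarrow> (p + h * e, q + h * f) \<in> T"
    for g :: "real \<times> real \<Rightarrow> real" and a b p q e f
    by (rule continuous_on_compose2[OF that(1)]) (auto intro!: continuous_intros that(2))
  have halve: "bd (B / 2)" if bd: "bd B" and B: "B \<ge> 0" for B
  proof -
    have Fb: "\<bar>F i (s, y)\<bar> \<le> K' * B * exp (l * s)"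
      if i: "i \<in> A" and s: "0 < s" "0 < y" "s + y \<le> c" for i s y
    proof -
      have "(s, y) \<in> T" using s by (auto simp: T_def)
      have "\<bar>U j (s, y)\<bar> + \<bar>Us j (s, y)\<bar> + \<bar>Uy j (s, y)\<bar> \<le> 3 * (B * exp (l * s))" if "j \<in> A" for j
        using bd[unfolded bd_def, rule_format, OF that \<open>(s, y) \<in> T\<close>] by linarith
      then have "(\<Sum>j\<in>A. \<bar>U j (s, y)\<bar> + \<bar>Us j (s, y)\<bar> + \<bar>Uy j (s, y)\<bar>) \<le> card A * (3 * (B * exp (l * s)))"
        by (rule sum_bounded_above)
      then have "\<bar>K\<bar> * (\<Sum>j\<in>A. \<bar>U j (s, y)\<bar> + \<bar>Us j (s, y)\<bar> + \<bar>Uy j (s, y)\<bar>)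
          \<le> \<bar>K\<bar> * (card A * (3 * (B * exp (l * s))))" by (intro mult_left_mono) auto
      also have "\<dots> \<le> K' * B * exp (l * s)" using B by (simp add: K'_def algebra_simps)
      finally have 1: "\<bar>K\<bar> * (\<Sum>j\<in>A. \<bar>U j (s, y)\<bar> + \<bar>Us j (s, y)\<bar> + \<bar>Uy j (s, y)\<bar>) \<le> K' * B * exp (l * s)" .
      have "K * (\<Sum>j\<in>A. \<bar>U j (s, y)\<bar> + \<bar>Us j (s, y)\<bar> + \<bar>Uy j (s, y)\<bar>)
          \<le> \<bar>K\<bar> * (\<Sum>j\<in>A. \<bar>U j (s, y)\<bar> + \<bar>Us j (s, y)\<bar> + \<bar>Uy j (s, y)\<bar>)"
        by (intro mult_right_mono sum_nonneg) auto
      with 1 F[OF i s] show ?thesis by linarith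
    qed
    have inc: "C / l * (exp (l * b) - exp (l * a)) \<le> B / 4 * (exp (l * b) - exp (l * a))"
      if "a \<le> b" "C \<le> K' * B" for a b C
    proof (rule mult_right_mono)
      show "C / l \<le> B / 4" using that l K' by (simp add: l_def field_simps)
      show "0 \<le> exp (l * b) - exp (l * a)" using that l by simp
    qed
    \<comment> \<open>Followed backwards, s + y = const reaches s = 0 without meeting y = 0 on the
      way. These two bounds therefore use only the initial data and can precede the one for
      \<open>?Q\<close>.\<close>
    have P: "\<bar>?P i (s, y)\<bar> \<le> B / 4 * exp (l * s)" and U: "\<bar>U i (s, y)\<bar> \<le> B / 4 * exp (l * s)"
      if i: "i \<in> A" and T: "(s, y) \<in> T" for i s y
    proof -
      have sy: "0 \<le> s" "0 \<le> y" "s + y \<le> c" using T by (auto simp: T_def)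
      have seg: "(0 + h * 1, (s + y) + h * (-1)) \<in> T" if "0 \<le> h" "h \<le> s" for h
        using that sy by (auto simp: T_def)
      have c1: "continuous_on {0..s} (\<lambda>h. ?P i (h, s + y - h))"
        using line[OF _ seg, of "?P i" 0 s] cont i by (simp add: continuous_intros)
      have d1: "((\<lambda>h. ?P i (h, s + y - h)) has_real_derivative F i (h, s + y - h)) (at h)"
        if "0 < h" "h < s" for h
      proof (subst has_real_derivative_shift_0[symmetric])
        show "((\<lambda>k. ?P i (h + k, s + y - (h + k))) has_real_derivative F i (h, s + y - h)) (at 0)"
          using dP[OF i, of h "s + y - h"] that sy by (simp add: algebra_simps)
      qed
      have "\<bar>?P i (s, s + y - s) - ?P i (0, s + y - 0)\<bar> \<le> K' * B / l * (exp (l * s) - exp (l * 0))"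
        by (rule exp_increment_bound[OF sy(1) l c1 d1]) (use sy in \<open>auto intro!: Fb[OF i]\<close>)
      also have "\<dots> \<le> B / 4 * (exp (l * s) - exp (l * 0))" using inc[of 0 s "K' * B"] sy by simp
      finally have "\<bar>?P i (s, y)\<bar> \<le> B / 4 * (exp (l * s) - exp (l * 0))" using init[OF i, of "s + y"] sy by simp
      also have "\<dots> \<le> B / 4 * exp (l * s)" using B by (intro mult_left_mono) auto
      finally show "\<bar>?P i (s, y)\<bar> \<le> B / 4 * exp (l * s)" .
      have c2: "continuous_on {0..s} (\<lambda>h. U i (h, s + y - h))"
        using line[OF _ seg, of "U i" 0 s] cont i by (simp add: continuous_intros)
      have d2: "((\<lambda>h. U i (h, s + y - h)) has_real_derivative ?Q i (h, s + y - h)) (at h)"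
        if "0 < h" "h < s" for h
      proof (subst has_real_derivative_shift_0[symmetric])
        show "((\<lambda>k. U i (h + k, s + y - (h + k))) has_real_derivative ?Q i (h, s + y - h)) (at 0)"
          using dU[OF i, of h "s + y - h"] that sy by (simp add: algebra_simps)
      qed
      have "\<bar>?Q i (h, s + y - h)\<bar> \<le> B * exp (l * h)" if "0 < h" "h < s" for h
        using bd[unfolded bd_def, rule_format, OF i, of h "s + y - h"] that seg[of h] by auto
      then have "\<bar>U i (s, s + y - s) - U i (0, s + y - 0)\<bar> \<le> B / l * (exp (l * s) - exp (l * 0))"
        by (intro exp_increment_bound[OF sy(1) l c2 d2])
      also have "\<dots> \<le> B / 4 * (exp (l * s) - exp (l * 0))"
        using inc[of 0 s B] sy mult_right_mono[OF K' B] by simp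
      finally have "\<bar>U i (s, y)\<bar> \<le> B / 4 * (exp (l * s) - exp (l * 0))" using init[OF i, of "s + y"] sy by simp
      also have "\<dots> \<le> B / 4 * exp (l * s)" using B by (intro mult_left_mono) auto
      finally show "\<bar>U i (s, y)\<bar> \<le> B / 4 * exp (l * s)" .
    qed
    have Q: "\<bar>?Q i (s, y)\<bar> \<le> B / 2 * exp (l * s)"
      if i: "i \<in> A" and T: "(s, y) \<in> T" for i s y
    proof -
      have sy: "0 \<le> s" "0 \<le> y" "s + y \<le> c" using T by (auto simp: T_def)
      \<comment> \<open>The time at which y - s = const, followed backwards, leaves the triangle:
        through s = 0 if s \<le> y, and otherwise through y = 0.\<close>
      define a where "a = max 0 (s - y)"
      have a: "0 \<le> a" "a \<le> s" "0 \<le> a + (y - s)" using sy by (auto simp: a_def)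
      have seg: "(0 + h * 1, (y - s) + h * 1) \<in> T" if "a \<le> h" "h \<le> s" for h
        using that sy by (auto simp: T_def a_def)
      have c1: "continuous_on {a..s} (\<lambda>h. ?Q i (h, y - s + h))"
        using line[OF _ seg, of "?Q i" a s] cont i by (simp add: continuous_intros)
      have d1: "((\<lambda>h. ?Q i (h, y - s + h)) has_real_derivative F i (h, y - s + h)) (at h)"
        if "a < h" "h < s" for h
      proof (subst has_real_derivative_shift_0[symmetric])
        show "((\<lambda>k. ?Q i (h + k, y - s + (h + k))) has_real_derivative F i (h, y - s + h)) (at 0)"
          using dQ[OF i, of h "y - s + h"] that sy a by (simp add: algebra_simps)
      qed
      have "\<bar>?Q i (s, y - s + s) - ?Q i (a, y - s + a)\<bar> \<le> K' * B / l * (exp (l * s) - exp (l * a))"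
        by (rule exp_increment_bound[OF a(2) l c1 d1]) (use sy a in \<open>auto intro!: Fb[OF i]\<close>)
      also have "\<dots> \<le> B / 4 * (exp (l * s) - exp (l * a))" using inc[of a s "K' * B"] a by simp
      finally have 1: "\<bar>?Q i (s, y) - ?Q i (a, y - s + a)\<bar> \<le> B / 4 * (exp (l * s) - exp (l * a))" by simp
      \<comment> \<open>At y = 0 the reflection law turns \<open>?Q\<close> into \<open>?P\<close>,
        which is already bounded. The result is exactly the term subtracted in the increment
        estimate, so the two telescope.\<close>
      have "\<bar>?Q i (a, y - s + a)\<bar> \<le> B / 4 * exp (l * a)"
      proof (cases "s - y \<le> 0")
        case True
        then have "a = 0" by (simp add: a_def)
        then show ?thesis using init[OF i, of "y - s + a"] sy a B by simp
      next
        case False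
        then have "a = s - y" "y - s + a = 0" by (simp_all add: a_def)
        moreover have "\<bar>?P i (a, 0)\<bar> \<le> B / 4 * exp (l * a)"
          by (rule P[OF i]) (use sy a in \<open>auto simp: T_def\<close>)
        moreover have "\<bar>?P i (a, 0)\<bar> = \<bar>?Q i (a, 0)\<bar>"
          using bdry[OF i, of a] sy a False \<open>a = s - y\<close> by auto
        ultimately show ?thesis by simp
      qed
      with 1[unfolded right_diff_distrib] have "\<bar>?Q i (s, y)\<bar> \<le> B / 4 * exp (l * s)" by linarith
      also have "\<dots> \<le> B / 2 * exp (l * s)" using B by (intro mult_right_mono) auto
      finally show ?thesis .
    qed
    have "B / 4 * exp (l * s) \<le> B / 2 * exp (l * s)" for s
      using B by (intro mult_right_mono) auto
    note q = this
    show ?thesis unfolding bd_def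
      using Q order_trans[OF P q] order_trans[OF U q] by blast
  qed
  have comp: "compact T"
  proof -
    have "closed T"
      unfolding T_def case_prod_beta by (intro closed_Collect_conj closed_Collect_le continuous_intros)
    moreover have "T \<subseteq> cbox (0, 0) (c, c)" by (auto simp: T_def)
    ultimately show ?thesis by (meson bounded_cbox bounded_subset compact_eq_bounded_closed)
  qed
  have ex: "\<exists>B\<ge>0. \<forall>z\<in>T. \<bar>g z\<bar> \<le> B" if "continuous_on T g" for g :: "real \<times> real \<Rightarrow> real"
  proof -
    have "bounded (g ` T)" using comp compact_continuous_image compact_imp_bounded that by blast
    then obtain B where "B > 0" "\<forall>x\<in>g ` T. norm x \<le> B" unfolding bounded_pos by blast
    then show ?thesis by (intro exI[of _ B]) auto
  qed
  obtain b1 where b1: "\<And>i. i \<in> A \<Longrightarrow> b1 i \<ge> 0 \<and> (\<forall>z\<in>T. \<bar>U i z\<bar> \<le> b1 i)"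
    using ex[OF cont(1)] by metis
  obtain b2 where b2: "\<And>i. i \<in> A \<Longrightarrow> b2 i \<ge> 0 \<and> (\<forall>z\<in>T. \<bar>Us i z\<bar> \<le> b2 i)"
    using ex[OF cont(2)] by metis
  obtain b3 where b3: "\<And>i. i \<in> A \<Longrightarrow> b3 i \<ge> 0 \<and> (\<forall>z\<in>T. \<bar>Uy i z\<bar> \<le> b3 i)"
    using ex[OF cont(3)] by metis
  define B0 where "B0 = (\<Sum>i\<in>A. b1 i + b2 i + b3 i)"
  have B0: "b1 i + b2 i + b3 i \<le> B0" if "i \<in> A" for i
    unfolding B0_def by (rule member_le_sum[OF that]) (use b1 b2 b3 A in \<open>auto intro!: add_nonneg_nonneg\<close>)
  have B0p: "B0 \<ge> 0" unfolding B0_def using b1 b2 b3 by (intro sum_nonneg add_nonneg_nonneg) auto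
  have "bd B0" unfolding bd_def
  proof (intro ballI allI impI)
    fix i s y assume i: "i \<in> A" and T: "(s, y) \<in> T"
    then have "l * s \<ge> 0" using l by (auto simp: T_def)
    then have "B0 * 1 \<le> B0 * exp (l * s)" using B0p by (intro mult_left_mono) auto
    moreover have "\<bar>U i (s, y)\<bar> \<le> b1 i" "\<bar>Us i (s, y)\<bar> \<le> b2 i" "\<bar>Uy i (s, y)\<bar> \<le> b3 i"
      using b1 b2 b3 i T by blast+
    ultimately show "\<bar>U i (s, y)\<bar> \<le> B0 * exp (l * s)
      \<and> \<bar>?P i (s, y)\<bar> \<le> B0 * exp (l * s) \<and> \<bar>?Q i (s, y)\<bar> \<le> B0 * exp (l * s)"
      using b1[OF i] b2[OF i] b3[OF i] B0[OF i] by linarith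
  qed
  then have bdk: "bd (B0 / 2 ^ k)" for k
  proof (induction k)
    case (Suc k)
    with halve[of "B0 / 2 ^ k"] B0p show ?case by (simp add: mult.commute)
  qed simp
  have lim: "(\<lambda>k. B0 / 2 ^ k * exp (l * s)) \<longlonglongrightarrow> 0"
  proof -
    have "(\<lambda>k. B0 * (1 / 2) ^ k * exp (l * s)) \<longlonglongrightarrow> B0 * 0 * exp (l * s)"
      by (intro tendsto_intros LIMSEQ_power_zero) auto
    then show ?thesis by (simp add: power_one_over)
  qed
  have z: "x = 0" if "\<And>k. \<bar>x\<bar> \<le> B0 / 2 ^ k * exp (l * s)" for x
    using LIMSEQ_le_const[OF lim, of "\<bar>x\<bar>"] that by auto
  show "U i (s, y) = 0" using bdk i T by (intro z) (auto simp: bd_def)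
  moreover have "?P i (s, y) = 0" using bdk i T by (intro z) (auto simp: bd_def)
  moreover have "?Q i (s, y) = 0" using bdk i T by (intro z) (auto simp: bd_def)
  ultimately show "Us i (s, y) = 0" "Uy i (s, y) = 0" by auto
qed

subsection \<open>Calculus\<close>

text \<open>The second difference of \<open>u\<close> over the parallelogram spanned by s v and s w
  is symmetric in v and w. One mean value step in direction v, followed by the first-order expansion
  of \<open>G\<close> at \<open>p\<close>, shows that it equals s^2 (H w \<bullet> v) up to
  o(s^2).\<close>

lemma gradient_derivative_symmetric:
  fixes u :: "'a::real_inner \<Rightarrow> real" and G :: "'a \<Rightarrow> 'a"
  assumes X: "open X" "p \<in> X"
    and u: "\<And>q. q \<in> X \<Longrightarrow> (u has_derivative (\<lambda>h. G q \<bullet> h)) (at q)"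
    and G: "(G has_derivative H) (at p)"
  shows "H v \<bullet> w = H w \<bullet> v"
proof -
  interpret H: bounded_linear H using G by (rule has_derivative_bounded_linear)
  define \<Delta> where "\<Delta> s v w = u (p + s *\<^sub>R v + s *\<^sub>R w) - u (p + s *\<^sub>R v) - u (p + s *\<^sub>R w) + u p" for s v w
  have sym: "\<Delta> s v w = \<Delta> s w v" for s v w by (simp add: \<Delta>_def add.commute add.left_commute)
  have key: "\<exists>d>0. \<forall>s. 0 < s \<and> s < d \<longrightarrow> \<bar>\<Delta> s v w - s\<^sup>2 * (H w \<bullet> v)\<bar> \<le> e * s\<^sup>2" if "e > 0" for e v w
  proof -
    define N where "N = norm v + norm w + 1"
    have N: "N > 0" "norm v \<le> N" "norm w \<le> N"
      using norm_ge_zero[of v] norm_ge_zero[of w] unfolding N_def by linarith+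
    obtain d1 where d1: "d1 > 0" and Gd: "\<And>y. norm (y - p) < d1 \<Longrightarrow>
        norm (G y - G p - H (y - p)) \<le> (e / (3 * N\<^sup>2)) * norm (y - p)"
      using G \<open>e > 0\<close> N unfolding has_derivative_at_alt
      by (metis divide_pos_pos zero_less_mult_iff zero_less_numeral zero_less_power)
    obtain d2 where d2: "d2 > 0" "ball p d2 \<subseteq> X" using X openE by blast
    \<comment> \<open>Points of the parallelogram with s < d differ from \<open>p\<close> by at most
      2 s N, hence stay in both balls.\<close>
    define d where "d = min d1 d2 / (2 * N)"
    have "d > 0" using d1 d2 N by (simp add: d_def)
    moreover have "\<bar>\<Delta> s v w - s\<^sup>2 * (H w \<bullet> v)\<bar> \<le> e * s\<^sup>2" if s: "0 < s" "s < d" for s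
    proof -
      have small: "norm (\<tau> *\<^sub>R v + \<sigma> *\<^sub>R w) < min d1 d2" "norm (\<tau> *\<^sub>R v + \<sigma> *\<^sub>R w) \<le> \<tau> * norm v + \<sigma> * norm w"
        if "0 \<le> \<tau>" "\<tau> \<le> s" "0 \<le> \<sigma>" "\<sigma> \<le> s" for \<tau> \<sigma>
      proof -
        show 1: "norm (\<tau> *\<^sub>R v + \<sigma> *\<^sub>R w) \<le> \<tau> * norm v + \<sigma> * norm w"
          using norm_triangle_ineq[of "\<tau> *\<^sub>R v" "\<sigma> *\<^sub>R w"] that by simp
        also have "\<dots> \<le> s * N + s * N"
          using that N by (intro add_mono mult_mono) auto
        also have "\<dots> < min d1 d2" using s N by (simp add: d_def field_simps)
        finally show "norm (\<tau> *\<^sub>R v + \<sigma> *\<^sub>R w) < min d1 d2" .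
      qed
      define \<phi> where "\<phi> \<tau> = u (p + (\<tau> *\<^sub>R v + s *\<^sub>R w)) - u (p + (\<tau> *\<^sub>R v + 0 *\<^sub>R w))" for \<tau>
      define \<phi>' where "\<phi>' \<tau> = G (p + (\<tau> *\<^sub>R v + s *\<^sub>R w)) \<bullet> v - G (p + (\<tau> *\<^sub>R v + 0 *\<^sub>R w)) \<bullet> v" for \<tau>
      have du: "((\<lambda>\<tau>. u (p + (\<tau> *\<^sub>R v + \<sigma> *\<^sub>R w))) has_derivative (\<lambda>h. h * (G (p + (\<tau> *\<^sub>R v + \<sigma> *\<^sub>R w)) \<bullet> v))) (at \<tau>)"
        if "0 \<le> \<tau>" "\<tau> \<le> s" "0 \<le> \<sigma>" "\<sigma> \<le> s" for \<tau> \<sigma>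
      proof -
        have "p + (\<tau> *\<^sub>R v + \<sigma> *\<^sub>R w) \<in> X" using small(1)[OF that] d2 by (auto simp: subset_iff dist_norm norm_minus_commute)
        then have "(u has_derivative (\<bullet>) (G (p + (\<tau> *\<^sub>R v + \<sigma> *\<^sub>R w)))) (at (p + (\<tau> *\<^sub>R v + \<sigma> *\<^sub>R w)))"
          by (rule u)
        moreover have "((\<lambda>\<tau>. p + (\<tau> *\<^sub>R v + \<sigma> *\<^sub>R w)) has_derivative (\<lambda>h. h *\<^sub>R v)) (at \<tau>)"
          by (auto intro!: derivative_eq_intros)
        ultimately show ?thesis using has_derivative_compose by fastforce
      qed
      have "\<exists>\<xi>\<in>{0<..<s}. \<phi> s - \<phi> 0 = (s - 0) * \<phi>' \<xi>"
        using mvt_simple[OF s(1), of \<phi> "\<lambda>\<tau> h. h * \<phi>' \<tau>"] s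
          has_derivative_diff[OF du du, of _ s 0, THEN has_derivative_at_withinI]
        unfolding \<phi>_def \<phi>'_def right_diff_distrib by fastforce
      then obtain \<xi> where \<xi>: "0 < \<xi>" "\<xi> < s" "\<phi> s - \<phi> 0 = s * \<phi>' \<xi>" by auto
      have "\<Delta> s v w = \<phi> s - \<phi> 0" by (simp add: \<Delta>_def \<phi>_def add.assoc)
      define R where "R y = G (p + y) - G p - H y" for y
      have R: "norm (R y) \<le> e / (3 * N\<^sup>2) * norm y" if "norm y < min d1 d2" for y
        using Gd[of "p + y"] that by (simp add: R_def)
      have "\<phi>' \<xi> - s * (H w \<bullet> v) = (R (\<xi> *\<^sub>R v + s *\<^sub>R w) - R (\<xi> *\<^sub>R v + 0 *\<^sub>R w)) \<bullet> v"
        by (simp add: \<phi>'_def R_def H.add H.scaleR inner_simps)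
      then have "\<bar>\<phi>' \<xi> - s * (H w \<bullet> v)\<bar> \<le> norm (R (\<xi> *\<^sub>R v + s *\<^sub>R w) - R (\<xi> *\<^sub>R v + 0 *\<^sub>R w)) * norm v"
        by (simp add: Cauchy_Schwarz_ineq2)
      \<comment> \<open>The arguments of the two remainders have norm at most 2 s N and s N, and v
        has norm at most N. The total 3 s N^2 is what the denominator in the choice of
        \<open>d1\<close> anticipates.\<close>
      also have "\<dots> \<le> (e / (3 * N\<^sup>2) * (s * N + s * norm w) + e / (3 * N\<^sup>2) * (s * N)) * norm v"
      proof (intro mult_right_mono order_trans[OF norm_triangle_ineq4] add_mono norm_ge_zero)
        have 1: "\<xi> * norm v \<le> s * N" using \<xi> N s by (intro mult_mono) auto
        show "norm (R (\<xi> *\<^sub>R v + s *\<^sub>R w)) \<le> e / (3 * N\<^sup>2) * (s * N + s * norm w)"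
        proof (rule order_trans[OF R[OF small(1)]])
          show "e / (3 * N\<^sup>2) * norm (\<xi> *\<^sub>R v + s *\<^sub>R w) \<le> e / (3 * N\<^sup>2) * (s * N + s * norm w)"
            using small(2)[of \<xi> s] \<xi> s 1 \<open>e > 0\<close> by (intro mult_left_mono) auto
        qed (use \<xi> s in auto)
        show "norm (R (\<xi> *\<^sub>R v + 0 *\<^sub>R w)) \<le> e / (3 * N\<^sup>2) * (s * N)"
        proof (rule order_trans[OF R[OF small(1)]])
          show "e / (3 * N\<^sup>2) * norm (\<xi> *\<^sub>R v + 0 *\<^sub>R w) \<le> e / (3 * N\<^sup>2) * (s * N)"
            using small(2)[of \<xi> 0] \<xi> s 1 \<open>e > 0\<close> by (intro mult_left_mono) auto
        qed (use \<xi> s in auto)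
      qed
      also have "\<dots> \<le> (e / (3 * N\<^sup>2) * (s * N + s * N) + e / (3 * N\<^sup>2) * (s * N)) * N"
        using N s \<open>e > 0\<close> by (intro mult_mono add_mono add_nonneg_nonneg mult_nonneg_nonneg order_refl) auto
      also have "\<dots> = e * s" using N by (simp add: field_simps power2_eq_square)
      finally have "\<bar>\<phi>' \<xi> - s * (H w \<bullet> v)\<bar> \<le> e * s" .
      then have "s * \<bar>\<phi>' \<xi> - s * (H w \<bullet> v)\<bar> \<le> s * (e * s)" using s by (intro mult_left_mono) auto
      moreover have "\<Delta> s v w - s\<^sup>2 * (H w \<bullet> v) = s * (\<phi>' \<xi> - s * (H w \<bullet> v))"
        using \<open>\<Delta> s v w = \<phi> s - \<phi> 0\<close> \<xi> by (simp add: right_diff_distrib power2_eq_square)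
      then have "\<bar>\<Delta> s v w - s\<^sup>2 * (H w \<bullet> v)\<bar> = s * \<bar>\<phi>' \<xi> - s * (H w \<bullet> v)\<bar>"
        using s by (simp add: abs_mult)
      moreover have "s * (e * s) = e * s\<^sup>2" by (simp add: power2_eq_square)
      ultimately show ?thesis by linarith
    qed
    ultimately show ?thesis by blast
  qed
  have "\<bar>H v \<bullet> w - H w \<bullet> v\<bar> \<le> 0 + e" if e: "e > 0" for e
  proof -
    obtain d1 where d1: "d1 > 0" "\<And>s. 0 < s \<Longrightarrow> s < d1 \<Longrightarrow> \<bar>\<Delta> s v w - s\<^sup>2 * (H w \<bullet> v)\<bar> \<le> e / 2 * s\<^sup>2"
      using key[OF half_gt_zero[OF e], of v w] by blast
    obtain d2 where d2: "d2 > 0" "\<And>s. 0 < s \<Longrightarrow> s < d2 \<Longrightarrow> \<bar>\<Delta> s w v - s\<^sup>2 * (H v \<bullet> w)\<bar> \<le> e / 2 * s\<^sup>2"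
      using key[OF half_gt_zero[OF e], of w v] by blast
    define s where "s = min d1 d2 / 2"
    have s: "0 < s" "s < d1" "s < d2" using d1 d2 by (auto simp: s_def)
    from d1(2)[OF s(1,2)] d2(2)[OF s(1,3)] have "\<bar>s\<^sup>2 * (H v \<bullet> w) - s\<^sup>2 * (H w \<bullet> v)\<bar> \<le> e * s\<^sup>2"
      unfolding sym[of s w v] by linarith
    then have "s\<^sup>2 * \<bar>H v \<bullet> w - H w \<bullet> v\<bar> \<le> s\<^sup>2 * e"
      by (simp add: abs_mult flip: right_diff_distrib) (simp add: mult.commute)
    then show ?thesis using s by simp
  qed
  then have "\<bar>H v \<bullet> w - H w \<bullet> v\<bar> \<le> 0" by (rule field_le_epsilon)
  then show ?thesis by simp
qed

subsection \<open>Integrals over compact sets depending on a parameter\<close>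

lemma set_integrable_compact_continuous:
  fixes f :: "'a::euclidean_space \<Rightarrow> real"
  assumes "compact K" "continuous_on K f"
  shows "set_integrable lborel K f"
  using borel_integrable_compact[OF assms] by (simp add: set_integrable_def indicator_scaleR_eq_if)

lemma continuous_on_slices:
  assumes "continuous_on (X \<times> K) (\<lambda>(z, x). f z x)"
  shows "z \<in> X \<Longrightarrow> continuous_on K (f z)" "x \<in> K \<Longrightarrow> continuous_on X (\<lambda>z. f z x)"
proof -
  assume "z \<in> X"
  have "continuous_on K (\<lambda>x. case (z, x) of (z, x) \<Rightarrow> f z x)"
    by (rule continuous_on_compose2[OF assms]) (use \<open>z \<in> X\<close> in \<open>auto intro!: continuous_intros\<close>)
  then show "continuous_on K (f z)" by simp
next
  assume "x \<in> K"
  have "continuous_on X (\<lambda>z. case (z, x) of (z, x) \<Rightarrow> f z x)"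
    by (rule continuous_on_compose2[OF assms]) (use \<open>x \<in> K\<close> in \<open>auto intro!: continuous_intros\<close>)
  then show "continuous_on X (\<lambda>z. f z x)" by simp
qed

text \<open>Dominated convergence along sequences. A convergent sequence together with its limit is
  compact, so \<open>f\<close> is bounded on its product with \<open>K\<close> and a constant on
  \<open>K\<close> dominates.\<close>

lemma continuous_on_set_lebesgue_integral_param:
  fixes f :: "'b::heine_borel \<Rightarrow> 'a::euclidean_space \<Rightarrow> real"
  assumes K: "compact K" and f: "continuous_on (X \<times> K) (\<lambda>(z, x). f z x)"
  shows "continuous_on X (\<lambda>z. LINT x:K|lborel. f z x)"
  unfolding continuous_on_sequentially
proof (intro allI ballI impI)
  fix \<xi> :: "nat \<Rightarrow> 'b" and a assume "a \<in> X" and *: "(\<forall>n. \<xi> n \<in> X) \<and> \<xi> \<longlonglongrightarrow> a"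
  note slice = continuous_on_slices(1)[OF f]
  have cZ: "compact (insert a (range \<xi>) \<times> K)"
    using compact_sequence_with_limit * K by (intro compact_Times) auto
  have "continuous_on (insert a (range \<xi>) \<times> K) (\<lambda>(z, x). f z x)"
    using * \<open>a \<in> X\<close> by (intro continuous_on_subset[OF f]) auto
  then have "bounded ((\<lambda>(z, x). f z x) ` (insert a (range \<xi>) \<times> K))"
    using cZ compact_continuous_image compact_imp_bounded by blast
  then obtain B where B: "\<And>z x. z \<in> insert a (range \<xi>) \<Longrightarrow> x \<in> K \<Longrightarrow> \<bar>f z x\<bar> \<le> B"
    unfolding bounded_iff by fastforce
  show "((\<lambda>z. LINT x:K|lborel. f z x) \<circ> \<xi>) \<longlonglongrightarrow> (LINT x:K|lborel. f a x)"
    unfolding comp_def set_lebesgue_integral_def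
  proof (rule integral_dominated_convergence)
    show "integrable lborel (\<lambda>x. indicator K x *\<^sub>R B)"
      using set_integrable_compact_continuous[OF K continuous_on_const] by (simp add: set_integrable_def)
    show "(\<lambda>x. indicator K x *\<^sub>R f a x) \<in> borel_measurable lborel"
      using set_integrable_compact_continuous[OF K slice[OF \<open>a \<in> X\<close>]] by (auto simp: set_integrable_def)
    show "(\<lambda>x. indicator K x *\<^sub>R f (\<xi> i) x) \<in> borel_measurable lborel" for i
      using set_integrable_compact_continuous[OF K slice] * by (auto simp: set_integrable_def)
    show "AE x in lborel. norm (indicator K x *\<^sub>R f (\<xi> i) x) \<le> indicator K x *\<^sub>R B" for i
      using B by (intro AE_I2) (auto simp: indicator_def)
    show "AE x in lborel. (\<lambda>i. indicator K x *\<^sub>R f (\<xi> i) x) \<longlonglongrightarrow> indicator K x *\<^sub>R f a x"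
    proof (rule AE_I2)
      fix x
      show "(\<lambda>i. indicator K x *\<^sub>R f (\<xi> i) x) \<longlonglongrightarrow> indicator K x *\<^sub>R f a x"
      proof (cases "x \<in> K")
        case True
        from continuous_on_tendsto_compose[OF continuous_on_slices(2)[OF f True], of \<xi> a sequentially]
        show ?thesis using * \<open>a \<in> X\<close> True by simp
      qed simp
    qed
  qed
qed

text \<open>Dominated convergence for the difference quotients, which the mean value inequality
  bounds by the maximum of \<open>f'\<close> over a compact neighbourhood of \<open>s0\<close> times
  \<open>K\<close>.\<close>

lemma has_real_derivative_set_lebesgue_integral:
  fixes f :: "real \<Rightarrow> 'a::euclidean_space \<Rightarrow> real"
  assumes K: "compact K" and J: "open J" "s0 \<in> J"
    and f: "\<And>s. s \<in> J \<Longrightarrow> continuous_on K (f s)"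
    and d: "\<And>s x. s \<in> J \<Longrightarrow> x \<in> K \<Longrightarrow> ((\<lambda>s. f s x) has_real_derivative f' s x) (at s)"
    and f': "continuous_on (J \<times> K) (\<lambda>(s, x). f' s x)"
  shows "((\<lambda>s. LINT x:K|lborel. f s x) has_real_derivative (LINT x:K|lborel. f' s0 x)) (at s0)"
proof -
  obtain e where e: "e > 0" "cball s0 e \<subseteq> J" using J open_contains_cball by blast
  have "bounded ((\<lambda>(z, x). f' z x) ` (cball s0 e \<times> K))"
    using continuous_on_subset[OF f', of "cball s0 e \<times> K"] e K
    by (intro compact_imp_bounded compact_continuous_image compact_Times) auto
  then obtain B where B: "\<And>z x. z \<in> cball s0 e \<Longrightarrow> x \<in> K \<Longrightarrow> \<bar>f' z x\<bar> \<le> B"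
    unfolding bounded_iff by fastforce
  have I: "set_integrable lborel K (f s)" if "s \<in> J" for s
    using set_integrable_compact_continuous[OF K f[OF that]] .
  have c': "continuous_on K (f' s0)"
    by (rule continuous_on_slices(1)[OF f' J(2)])
  have "((\<lambda>s. ((LINT x:K|lborel. f s x) - (LINT x:K|lborel. f s0 x)) / (s - s0)) \<longlongrightarrow>
      (LINT x:K|lborel. f' s0 x)) (at s0 within cball s0 e)"
    unfolding tendsto_at_iff_sequentially
  proof (intro allI impI)
    fix \<xi> :: "nat \<Rightarrow> real" assume \<xi>: "\<forall>i. \<xi> i \<in> cball s0 e - {s0}" "\<xi> \<longlonglongrightarrow> s0"
    have \<xi>J: "\<xi> i \<in> J" "\<xi> i \<noteq> s0" "\<xi> i \<in> cball s0 e" for i using \<xi> e by auto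
    have "(\<lambda>i. LINT x:K|lborel. (f (\<xi> i) x - f s0 x) / (\<xi> i - s0)) \<longlonglongrightarrow> (LINT x:K|lborel. f' s0 x)"
      unfolding set_lebesgue_integral_def
    proof (rule integral_dominated_convergence)
      show "integrable lborel (\<lambda>x. indicator K x *\<^sub>R B)"
        using set_integrable_compact_continuous[OF K continuous_on_const] by (simp add: set_integrable_def)
      show "(\<lambda>x. indicator K x *\<^sub>R f' s0 x) \<in> borel_measurable lborel"
        using set_integrable_compact_continuous[OF K c'] by (auto simp: set_integrable_def)
      show "(\<lambda>x. indicator K x *\<^sub>R ((f (\<xi> i) x - f s0 x) / (\<xi> i - s0))) \<in> borel_measurable lborel" for i
      proof -
        have "continuous_on K (\<lambda>x. (f (\<xi> i) x - f s0 x) / (\<xi> i - s0))"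
          using f[OF \<xi>J(1)] f[OF J(2)] \<xi>J(2) by (intro continuous_intros) auto
        from set_integrable_compact_continuous[OF K this] show ?thesis
          unfolding set_integrable_def by (rule borel_measurable_integrable)
      qed
      have "\<bar>(f (\<xi> i) x - f s0 x) / (\<xi> i - s0)\<bar> \<le> B" if "x \<in> K" for i x
      proof -
        have "norm (f (\<xi> i) x - f s0 x) \<le> B * norm (\<xi> i - s0)"
        proof (rule differentiable_bound[of "cball s0 e" "\<lambda>s. f s x" "\<lambda>s h. f' s x * h"])
          show "((\<lambda>s. f s x) has_derivative (*) (f' s x)) (at s within cball s0 e)" if "s \<in> cball s0 e" for s
          proof -
            have "s \<in> J" using that e by blast
            from d[OF this \<open>x \<in> K\<close>] show ?thesis
              unfolding has_field_derivative_def by (rule has_derivative_at_withinI)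
          qed
          show "onorm ((*) (f' s x)) \<le> B" if "s \<in> cball s0 e" for s
            using B[OF that \<open>x \<in> K\<close>] by (intro onorm_le) (simp add: abs_mult mult_right_mono)
        qed (use \<xi>J e in auto)
        then show ?thesis using \<xi>J(2)[of i] by (simp add: abs_divide field_simps)
      qed
      then show "AE x in lborel. norm (indicator K x *\<^sub>R ((f (\<xi> i) x - f s0 x) / (\<xi> i - s0)))
          \<le> indicator K x *\<^sub>R B" for i
        by (intro AE_I2) (auto simp: indicator_def)
      show "AE x in lborel. (\<lambda>i. indicator K x *\<^sub>R ((f (\<xi> i) x - f s0 x) / (\<xi> i - s0)))
          \<longlonglongrightarrow> indicator K x *\<^sub>R f' s0 x"
      proof (intro AE_I2)
        fix x
        show "(\<lambda>i. indicator K x *\<^sub>R ((f (\<xi> i) x - f s0 x) / (\<xi> i - s0))) \<longlonglongrightarrow> indicator K x *\<^sub>R f' s0 x"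
        proof (cases "x \<in> K")
          case True
          have "((\<lambda>y. (f y x - f s0 x) / (y - s0)) \<longlongrightarrow> f' s0 x) (at s0)"
            using d[OF J(2) True] by (simp add: has_field_derivative_iff)
          then have "((\<lambda>y. (f y x - f s0 x) / (y - s0)) \<circ> \<xi>) \<longlonglongrightarrow> f' s0 x"
            using \<xi> unfolding tendsto_at_iff_sequentially by auto
          then show ?thesis using True by (simp add: o_def)
        qed simp
      qed
    qed
    then show "((\<lambda>s. ((LINT x:K|lborel. f s x) - (LINT x:K|lborel. f s0 x)) / (s - s0)) \<circ> \<xi>)
        \<longlonglongrightarrow> (LINT x:K|lborel. f' s0 x)"
      using I[OF \<xi>J(1)] I[OF J(2)] by (simp add: o_def set_integral_diff)
  qed
  moreover have "at s0 within cball s0 e = at s0"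
    using e by (intro at_within_interior) simp
  ultimately show ?thesis by (simp add: has_field_derivative_iff)
qed

text \<open>Translation invariance, differentiated at shift 0. Shifts shorter than 1 keep the
  support, of radius 2, inside \<open>cball 0 3\<close>, so the integral over this fixed compact set
  does not depend on the shift.\<close>

lemma integral_directional_derivative_zero:
  fixes F :: "'a::euclidean_space \<Rightarrow> real"
  assumes F: "\<And>x. (F has_derivative DF x) (at x)"
    and DF: "continuous_on UNIV (\<lambda>x. DF x e)"
    and e: "norm e \<le> 1" and supp: "\<And>x. norm x > 2 \<Longrightarrow> F x = 0"
  shows "(LINT x:cball 0 3|lborel. DF x e) = 0"
proof -
  have cF: "continuous_on UNIV F"
    by (intro continuous_at_imp_continuous_on ballI has_derivative_continuous[OF F])
  have d: "((\<lambda>s. LINT x:cball 0 3|lborel. F (x + s *\<^sub>R e)) has_real_derivative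
      (LINT x:cball 0 3|lborel. DF (x + 0 *\<^sub>R e) e)) (at 0)"
  proof (rule has_real_derivative_set_lebesgue_integral[of _ "{-1<..<1}"])
    show "continuous_on (cball 0 3) (\<lambda>x. F (x + s *\<^sub>R e))" for s
      by (rule continuous_on_compose2[OF cF]) (auto intro!: continuous_intros)
    show "((\<lambda>s. F (x + s *\<^sub>R e)) has_real_derivative DF (x + s *\<^sub>R e) e) (at s)" for s x
    proof -
      have "((\<lambda>s. x + s *\<^sub>R e) has_derivative (\<lambda>h. h *\<^sub>R e)) (at s)"
        by (auto intro!: derivative_eq_intros)
      from has_derivative_compose[OF this F[of "x + s *\<^sub>R e"]]
      have "((\<lambda>s. F (x + s *\<^sub>R e)) has_derivative (\<lambda>h. DF (x + s *\<^sub>R e) (h *\<^sub>R e))) (at s)" .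
      also have "(\<lambda>h. DF (x + s *\<^sub>R e) (h *\<^sub>R e)) = (*) (DF (x + s *\<^sub>R e) e)"
        by (simp add: fun_eq_iff linear_scale[OF has_derivative_linear[OF F]])
      finally show ?thesis by (simp add: has_field_derivative_def)
    qed
    show "continuous_on ({-1<..<1} \<times> cball 0 3) (\<lambda>(s, x). DF (x + s *\<^sub>R e) e)"
      unfolding case_prod_beta
      by (rule continuous_on_compose2[OF DF]) (auto intro!: continuous_intros)
  qed auto
  have "(LINT x:cball 0 3|lborel. F (x + s *\<^sub>R e)) = (LINT x|lborel. F x)" if s: "s \<in> {-1<..<1}" for s
  proof -
    have "indicator (cball 0 3) x *\<^sub>R F (x + s *\<^sub>R e) = F (s *\<^sub>R e + x)" for x
    proof (cases "norm x \<le> 3")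
      case False
      have "\<bar>s\<bar> * norm e \<le> 1 * 1" using s e by (intro mult_mono) auto
      then have "norm (s *\<^sub>R e) \<le> 1" by simp
      then have "norm (x + s *\<^sub>R e) > 2"
        using False norm_diff_ineq[of x "s *\<^sub>R e"] by linarith
      then show ?thesis using supp by (simp add: add.commute)
    qed (simp add: add.commute)
    then have "(LINT x:cball 0 3|lborel. F (x + s *\<^sub>R e)) = (LINT x|lborel. F (s *\<^sub>R e + x))"
      unfolding set_lebesgue_integral_def by (intro Bochner_Integration.integral_cong) auto
    also have "\<dots> = (LINT x|distr lborel borel ((+) (s *\<^sub>R e)). F x)"
      using borel_measurable_continuous_onI[OF cF] by (subst integral_distr) auto
    finally show ?thesis by (simp add: lborel_distr_plus)
  qed
  note const = this
  have "((\<lambda>s. LINT x:cball 0 3|lborel. F (x + s *\<^sub>R e)) has_real_derivative 0) (at 0)"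
  proof (rule has_field_derivative_transform_within[OF DERIV_const zero_less_one UNIV_I])
    show "(LINT x|lborel. F x) = (LINT x:cball 0 3|lborel. F (x + s *\<^sub>R e))" if "dist s 0 < 1" for s :: real
      using that by (subst const) (auto simp: dist_real_def)
  qed
  with d have "(LINT x:cball 0 3|lborel. DF (x + 0 *\<^sub>R e) e) = 0" by (rule DERIV_unique)
  then show ?thesis by simp
qed

subsection \<open>A rotation invariant mean over the sphere\<close>

definition annulus :: "'a::real_inner set" where
  "annulus = cball 0 2 - ball 0 1"

text \<open>A radial weight that is positive exactly for 1 < |x| < 2. The square makes it C^1 across
  both boundary spheres, so integration by parts leaves no boundary terms.\<close>

definition bump :: "'a::real_inner \<Rightarrow> real" where
  "bump x = (max 0 ((x \<bullet> x - 1) * (4 - x \<bullet> x)))\<^sup>2"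

definition bump_deriv :: "'a::real_inner \<Rightarrow> 'a \<Rightarrow> real" where
  "bump_deriv x v = 2 * max 0 ((x \<bullet> x - 1) * (4 - x \<bullet> x)) * ((10 - 4 * (x \<bullet> x)) * (x \<bullet> v))"

text \<open>
  Up to a constant factor this is the surface integral; with a weighted Lebesgue integral over an
  annulus, rotation invariance reduces to translation invariance.
\<close>

definition sphere_mean :: "('a::euclidean_space \<Rightarrow> real) \<Rightarrow> real" where
  "sphere_mean f = (LINT x:annulus|lborel. bump x * f (sgn x))"

lemma compact_annulus: "compact (annulus :: 'a::euclidean_space set)"
  unfolding annulus_def by (intro compact_diff) auto

lemma annulus_nonzero: "x \<in> annulus \<Longrightarrow> x \<noteq> 0"
  by (auto simp: annulus_def)

lemma bump_eq_0_iff: "bump x = 0 \<longleftrightarrow> norm x \<le> 1 \<or> norm x \<ge> 2"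
proof -
  have "max 0 q = 0 \<longleftrightarrow> q \<le> 0" for q :: real by (auto simp: max_def)
  moreover have "(q - 1) * (4 - q) \<le> 0 \<longleftrightarrow> q \<le> 1 \<or> q \<ge> 4" for q :: real
    by (auto simp: mult_le_0_iff)
  moreover have "(norm x)\<^sup>2 \<le> 1 \<longleftrightarrow> norm x \<le> 1" by (simp add: power_le_one_iff)
  moreover have "4 \<le> (norm x)\<^sup>2 \<longleftrightarrow> 2 \<le> norm x"
    using abs_le_square_iff[of 2 "norm x"] by simp
  ultimately show ?thesis by (simp add: bump_def flip: power2_norm_eq_inner)
qed

lemma bump_nonneg: "bump x \<ge> 0"
  by (simp add: bump_def)

lemma has_derivative_bump: "(bump has_derivative bump_deriv x) (at x)"
proof -
  have sq: "((\<lambda>z::real. (max 0 z)\<^sup>2) has_real_derivative 2 * max 0 z) (at z)" for z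
  proof (cases "z = 0")
    case True
    have "((\<lambda>y::real. ((max 0 y)\<^sup>2 - (max 0 0)\<^sup>2) / (y - 0)) \<longlongrightarrow> 0) (at 0)"
    proof (rule Lim_null_comparison)
      show "\<forall>\<^sub>F y in at (0::real). norm (((max 0 y)\<^sup>2 - (max 0 0)\<^sup>2) / (y - 0)) \<le> \<bar>y\<bar>"
        by (intro always_eventually) (auto simp: max_def power2_eq_square)
      show "((\<lambda>y::real. \<bar>y\<bar>) \<longlongrightarrow> 0) (at 0)" by (auto intro!: tendsto_eq_intros)
    qed
    then show ?thesis using True by (simp add: has_field_derivative_iff)
  next
    case False
    then consider "z > 0" | "z < 0" by linarith
    then show ?thesis
    proof cases
      case 1
      have "((\<lambda>z::real. z\<^sup>2) has_real_derivative 2 * max 0 z) (at z)"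
        using 1 by (auto intro!: derivative_eq_intros)
      then show ?thesis
        by (rule has_field_derivative_transform_within[where d = z]) (use 1 in \<open>auto simp: dist_real_def max_def\<close>)
    next
      case 2
      have "((\<lambda>z::real. 0) has_real_derivative 2 * max 0 z) (at z)"
        using 2 by (auto intro!: derivative_eq_intros)
      then show ?thesis
        by (rule has_field_derivative_transform_within[where d = "- z"]) (use 2 in \<open>auto simp: dist_real_def max_def\<close>)
    qed
  qed
  have "((\<lambda>x. (x \<bullet> x - 1) * (4 - x \<bullet> x)) has_derivative (\<lambda>v. (10 - 4 * (x \<bullet> x)) * (x \<bullet> v))) (at x)"
    by (auto intro!: derivative_eq_intros simp: inner_commute algebra_simps)
  from has_derivative_compose[OF this sq[unfolded has_field_derivative_def]]
  show ?thesis unfolding bump_def bump_deriv_def[abs_def] .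
qed

lemma continuous_on_bump: "continuous_on S bump"
  unfolding bump_def by (intro continuous_intros)

lemma continuous_on_sgn: "0 \<notin> S \<Longrightarrow> continuous_on S (sgn :: 'a::real_normed_vector \<Rightarrow> 'a)"
  unfolding sgn_div_norm by (intro continuous_intros) auto

lemma sgn_annulus: "x \<in> annulus \<Longrightarrow> sgn x \<in> sphere 0 1"
  by (simp add: annulus_nonzero norm_sgn)

lemma continuous_on_mean_integrand:
  assumes "continuous_on (X \<times> sphere 0 1) (\<lambda>(z, \<omega>). f z \<omega>)"
  shows "continuous_on (X \<times> annulus) (\<lambda>(z, x). bump x * f z (sgn x))"
proof -
  have "continuous_on (X \<times> annulus) (\<lambda>p. case (fst p, sgn (snd p)) of (z, \<omega>) \<Rightarrow> f z \<omega>)"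
    by (rule continuous_on_compose2[OF assms])
      (use sgn_annulus in \<open>auto intro!: continuous_intros continuous_on_compose2[OF continuous_on_sgn]
         dest: annulus_nonzero\<close>)
  moreover have "continuous_on (X \<times> annulus) (\<lambda>p. bump (snd p))"
    by (rule continuous_on_compose2[OF continuous_on_bump]) (auto intro!: continuous_intros)
  ultimately show ?thesis unfolding case_prod_beta by (auto intro!: continuous_intros)
qed

lemma continuous_on_mean_integrand_single:
  assumes "continuous_on (sphere 0 1) f"
  shows "continuous_on annulus (\<lambda>x. bump x * f (sgn x))"
proof -
  have "continuous_on (UNIV \<times> sphere 0 1) (\<lambda>(z::real, \<omega>). f \<omega>)"
    unfolding case_prod_beta by (rule continuous_on_compose2[OF assms]) (auto intro!: continuous_intros)
  from continuous_on_slices(1)[OF continuous_on_mean_integrand[OF this]] show ?thesis by simp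
qed

lemma continuous_on_sphere_mean:
  fixes f :: "'b::heine_borel \<Rightarrow> 'a::euclidean_space \<Rightarrow> real"
  assumes "continuous_on (X \<times> sphere 0 1) (\<lambda>(z, \<omega>). f z \<omega>)"
  shows "continuous_on X (\<lambda>z. sphere_mean (f z))"
  unfolding sphere_mean_def
  by (rule continuous_on_set_lebesgue_integral_param[OF compact_annulus continuous_on_mean_integrand[OF assms]])

lemma has_real_derivative_sphere_mean:
  fixes f :: "real \<Rightarrow> 'a::euclidean_space \<Rightarrow> real"
  assumes J: "open J" "s0 \<in> J"
    and f: "\<And>s. s \<in> J \<Longrightarrow> continuous_on (sphere 0 1) (f s)"
    and d: "\<And>s \<omega>. s \<in> J \<Longrightarrow> \<omega> \<in> sphere 0 1 \<Longrightarrow> ((\<lambda>s. f s \<omega>) has_real_derivative f' s \<omega>) (at s)"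
    and f': "continuous_on (J \<times> sphere 0 1) (\<lambda>(s, \<omega>). f' s \<omega>)"
  shows "((\<lambda>s. sphere_mean (f s)) has_real_derivative sphere_mean (f' s0)) (at s0)"
  unfolding sphere_mean_def
proof (rule has_real_derivative_set_lebesgue_integral[OF compact_annulus J])
  show "continuous_on annulus (\<lambda>x. bump x * f s (sgn x))" if "s \<in> J" for s
    by (rule continuous_on_mean_integrand_single[OF f[OF that]])
  show "((\<lambda>s. bump x * f s (sgn x)) has_real_derivative bump x * f' s (sgn x)) (at s)"
    if "s \<in> J" "x \<in> annulus" for s x
    by (rule DERIV_cmult[OF d[OF that(1) sgn_annulus[OF that(2)]]])
qed (rule continuous_on_mean_integrand[OF f'])

lemma sphere_mean_cong: "(\<And>\<omega>. norm \<omega> = 1 \<Longrightarrow> f \<omega> = g \<omega>) \<Longrightarrow> sphere_mean f = sphere_mean g"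
  unfolding sphere_mean_def set_lebesgue_integral_def
  by (intro Bochner_Integration.integral_cong) (auto simp: indicator_def dest: sgn_annulus)

lemma sphere_mean_add:
  assumes "continuous_on (sphere 0 1) f" "continuous_on (sphere 0 1) g"
  shows "sphere_mean (\<lambda>\<omega>. f \<omega> + g \<omega>) = sphere_mean f + sphere_mean g"
  unfolding sphere_mean_def distrib_left
  by (intro set_integral_add set_integrable_compact_continuous compact_annulus
      continuous_on_mean_integrand_single assms)

lemma sphere_mean_cmult: "sphere_mean (\<lambda>\<omega>. c * f \<omega>) = c * sphere_mean f"
  unfolding sphere_mean_def by (simp add: mult.left_commute)

lemma sphere_mean_sum:
  assumes "finite I" "\<And>i. i \<in> I \<Longrightarrow> continuous_on (sphere 0 1) (f i)"
  shows "sphere_mean (\<lambda>\<omega>. \<Sum>i\<in>I. f i \<omega>) = (\<Sum>i\<in>I. sphere_mean (f i))"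
  using assms
proof (induction I)
  case empty
  show ?case by (simp add: sphere_mean_def)
next
  case (insert i I)
  then show ?case by (simp add: sphere_mean_add continuous_on_sum)
qed

lemma sphere_mean_mono:
  assumes "continuous_on (sphere 0 1) f" "continuous_on (sphere 0 1) g"
    and "\<And>\<omega>. norm \<omega> = 1 \<Longrightarrow> f \<omega> \<le> g \<omega>"
  shows "sphere_mean f \<le> sphere_mean g"
  unfolding sphere_mean_def
  by (intro set_integral_mono set_integrable_compact_continuous compact_annulus
      continuous_on_mean_integrand_single assms mult_left_mono bump_nonneg)
    (auto dest: sgn_annulus)

text \<open>If f is nonzero at \<omega>, the integrand is nonzero at 3/2 \<omega>, where the weight
  is positive, hence on a nonempty open set. Such a set is not negligible, whereas zero mean makes
  the integrand vanish almost everywhere.\<close>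

lemma sphere_mean_eq_0D:
  fixes f :: "'a::euclidean_space \<Rightarrow> real"
  assumes f: "continuous_on (sphere 0 1) f" "\<And>\<omega>. norm \<omega> = 1 \<Longrightarrow> f \<omega> \<ge> 0"
    and 0: "sphere_mean f = 0" and \<omega>: "norm \<omega> = 1"
  shows "f \<omega> = 0"
proof (rule ccontr)
  assume "f \<omega> \<noteq> 0"
  let ?g = "\<lambda>x. bump x * f (sgn x)"
  have c: "continuous_on annulus ?g" by (rule continuous_on_mean_integrand_single[OF f(1)])
  have "integrable lborel (\<lambda>x. indicator annulus x *\<^sub>R ?g x)"
    using set_integrable_compact_continuous[OF compact_annulus c] by (simp add: set_integrable_def)
  moreover have "0 \<le> indicator annulus x *\<^sub>R ?g x" for x
  proof (cases "x \<in> annulus")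
    case True
    then have "norm (sgn x) = 1" using sgn_annulus by auto
    then show ?thesis using True f(2) bump_nonneg[of x] by simp
  qed simp
  ultimately have "AE x in lborel. indicator annulus x *\<^sub>R ?g x = 0"
    using 0 by (simp add: integral_nonneg_eq_0_iff_AE sphere_mean_def set_lebesgue_integral_def)
  then have ae: "AE x in lebesgue. indicator annulus x *\<^sub>R ?g x = 0"
    by (rule AE_completion)
  define V where "V = {x \<in> ball 0 2 - cball 0 1. ?g x \<noteq> 0}"
  have "open V"
  proof -
    have "continuous_on (ball 0 2 - cball 0 1) ?g"
      by (rule continuous_on_subset[OF c]) (auto simp: annulus_def)
    then have "open ((ball 0 2 - cball 0 1) \<inter> ?g -` (- {0}))"
      by (intro continuous_open_preimage) auto
    then show ?thesis by (simp add: V_def vimage_def Int_def)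
  qed
  moreover have "(3/2) *\<^sub>R \<omega> \<in> V"
    using \<omega> \<open>f \<omega> \<noteq> 0\<close> by (auto simp: V_def bump_eq_0_iff sgn_scaleR sgn_div_norm)
  ultimately have "\<not> negligible V" using open_not_negligible by blast
  moreover have "V \<in> null_sets lebesgue"
  proof -
    have "AE x in lebesgue. x \<notin> V"
      using ae by eventually_elim (auto simp: V_def annulus_def)
    then show ?thesis using \<open>open V\<close> by (subst AE_iff_null_sets) auto
  qed
  ultimately show False by (simp add: negligible_iff_null_sets)
qed

text \<open>The vector field x_i d_j - x_j d_i, which generates the rotations of the (i, j) plane.
  All ordered pairs are allowed: i = j gives zero and a swap changes the sign, so sums of squares
  over all pairs count each plane twice.\<close>

definition rotgen :: "'n \<Rightarrow> 'n \<Rightarrow> real^'n \<Rightarrow> real^'n" where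
  "rotgen i j x = x $ i *\<^sub>R axis j 1 - x $ j *\<^sub>R axis i 1"

lemma linear_rotgen: "linear (rotgen i j)"
  by (rule linearI) (simp_all add: rotgen_def algebra_simps)

lemma inner_rotgen: "x \<bullet> rotgen i j x = 0"
  by (simp add: rotgen_def inner_diff_right inner_axis)

definition sgn_deriv :: "'a::real_inner \<Rightarrow> 'a \<Rightarrow> 'a" where
  "sgn_deriv x v = v /\<^sub>R norm x - ((x \<bullet> v) / norm x ^ 3) *\<^sub>R x"

lemma has_derivative_sgn:
  assumes "x \<noteq> 0"
  shows "(sgn has_derivative sgn_deriv x) (at x)"
proof -
  have "((\<lambda>x. x /\<^sub>R norm x) has_derivative (\<lambda>v. v /\<^sub>R norm x + (- (inverse (norm x) * (v \<bullet> sgn x) * inverse (norm x))) *\<^sub>R x)) (at x)"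
    using assms GDERIV_norm[OF assms] unfolding gderiv_def by (auto intro!: derivative_eq_intros)
  moreover have "(\<lambda>v. v /\<^sub>R norm x + (- (inverse (norm x) * (v \<bullet> sgn x) * inverse (norm x))) *\<^sub>R x) = sgn_deriv x"
    using assms by (auto simp: fun_eq_iff sgn_deriv_def sgn_div_norm power3_eq_cube inner_commute divide_inverse)
  ultimately show ?thesis by (simp add: sgn_div_norm[abs_def])
qed

text \<open>Extend g to be constant on rays and multiply by \<open>bump\<close>. The field is
  tangential, so it kills the radial weight and differentiates g alone. For distinct i and j the
  coordinate x_i passes through d_j, so x_i d_j F - x_j d_i F is a difference of directional
  derivatives of compactly supported functions, and both integrate to zero.\<close>

lemma sphere_mean_rotgen:
  fixes g :: "real^'n \<Rightarrow> real"
  assumes g: "\<And>\<omega>. norm \<omega> = 1 \<Longrightarrow> (g has_derivative Dg \<omega>) (at \<omega>)"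
    and Dg: "\<And>v. continuous_on (sphere 0 1) (\<lambda>\<omega>. Dg \<omega> v)"
  shows "sphere_mean (\<lambda>\<omega>. Dg \<omega> (rotgen i j \<omega>)) = 0"
proof (cases "i = j")
  case True
  have "sphere_mean (\<lambda>\<omega>. Dg \<omega> (rotgen i j \<omega>)) = sphere_mean (\<lambda>\<omega> :: real^'n. 0)"
    using True by (intro sphere_mean_cong) (simp add: rotgen_def linear_0[OF has_derivative_linear[OF g]])
  then show ?thesis by (simp add: sphere_mean_def)
next
  case False
  have lin: "linear (Dg \<omega>)" if "norm \<omega> = 1" for \<omega>
    by (rule has_derivative_linear[OF g[OF that]])
  define F where "F x = bump x * g (sgn x)" for x
  \<comment> \<open>\<open>sgn\<close> has no derivative at the origin. The value 0 is the correct
    one there because \<open>bump\<close> vanishes on the whole unit ball.\<close>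
  define DF where "DF x v = (if x = 0 then 0 else bump x * Dg (sgn x) (sgn_deriv x v) + bump_deriv x v * g (sgn x))" for x v
  have F: "(F has_derivative DF x) (at x)" for x
  proof (cases "x = 0")
    case True
    have "((\<lambda>x. 0) has_derivative DF x) (at x)"
      using True by (simp add: DF_def[abs_def])
    then show ?thesis
      by (rule has_derivative_transform_within_open[of _ _ _ _ "ball 0 1"])
        (use True in \<open>auto simp: F_def bump_eq_0_iff[THEN iffD2]\<close>)
  next
    case False
    then have "norm (sgn x) = 1" by (simp add: norm_sgn)
    from has_derivative_mult[OF has_derivative_bump has_derivative_compose[OF has_derivative_sgn[OF False] g[OF this]]]
    show ?thesis using False by (simp add: F_def[abs_def] DF_def[abs_def])
  qed
  have F0: "F x = 0" if "norm x > 2" for x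
    using that by (simp add: F_def bump_eq_0_iff[THEN iffD2])
  have cg: "continuous_on (sphere 0 1) g"
    by (intro continuous_at_imp_continuous_on ballI has_derivative_continuous[OF g]) simp
  have cDF: "continuous_on UNIV (\<lambda>x. DF x v)" for v
  proof -
    have s: "continuous_on (- {0}) (\<lambda>x. h (sgn x))" if "continuous_on (sphere 0 1) h" for h :: "real^'n \<Rightarrow> real"
      by (rule continuous_on_compose2[OF that continuous_on_sgn]) (auto simp: norm_sgn split: if_splits)
    \<comment> \<open>Continuity of \<open>Dg\<close> is given for each fixed direction only. The
      radial direction in \<open>sgn_deriv\<close> varies with x, so it is expanded in
      coordinates.\<close>
    have "continuous_on (- {0}) (\<lambda>x. bump x * (Dg (sgn x) v / norm x - ((x \<bullet> v) / norm x ^ 3) *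
        (\<Sum>k\<in>UNIV. x $ k * Dg (sgn x) (axis k 1))) + bump_deriv x v * g (sgn x))"
      unfolding bump_deriv_def
      by (intro continuous_intros continuous_on_bump s[OF Dg] s[OF cg]) auto
    also have "?this \<longleftrightarrow> continuous_on (- {0}) (\<lambda>x. DF x v)"
    proof (rule continuous_on_cong[OF refl])
      fix x :: "real^'n" assume "x \<in> - {0}"
      then have x: "x \<noteq> 0" "norm (sgn x) = 1" by (auto simp: norm_sgn)
      interpret linear "Dg (sgn x)" by (rule lin[OF x(2)])
      have "Dg (sgn x) x = (\<Sum>k\<in>UNIV. x $ k * Dg (sgn x) (axis k 1))"
        by (subst basis_expansion[symmetric, of x]) (simp add: sum scaleR scalar_mult_eq_scaleR)
      then show "bump x * (Dg (sgn x) v / norm x - ((x \<bullet> v) / norm x ^ 3) *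
          (\<Sum>k\<in>UNIV. x $ k * Dg (sgn x) (axis k 1))) + bump_deriv x v * g (sgn x) = DF x v"
        using x by (simp add: DF_def sgn_deriv_def diff scaleR divide_inverse mult.commute)
    qed
    finally have 1: "continuous_on (- {0}) (\<lambda>x. DF x v)" .
    have "continuous_on (ball 0 1) (\<lambda>x. DF x v) \<longleftrightarrow> continuous_on (ball (0::real^'n) 1) (\<lambda>x. 0 :: real)"
    proof (rule continuous_on_cong[OF refl])
      fix x :: "real^'n" assume "x \<in> ball 0 1"
      then have "bump x = 0" by (simp add: bump_eq_0_iff)
      then show "DF x v = 0" by (auto simp: DF_def bump_deriv_def bump_def)
    qed
    then have 2: "continuous_on (ball 0 1) (\<lambda>x. DF x v)" by simp
    have "continuous_on (- {0} \<union> ball 0 1) (\<lambda>x. DF x v)"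
      by (rule continuous_on_open_Un[OF _ _ 1 2]) auto
    then show ?thesis by (rule continuous_on_subset) auto
  qed
  have part: "(LINT x:cball 0 3|lborel. x $ k * DF x (axis l 1)) = 0"
    and I: "set_integrable lborel (cball 0 3) (\<lambda>x. x $ k * DF x (axis l 1))" if "k \<noteq> l" for k l
  proof -
    have c: "continuous_on UNIV (\<lambda>x. x $ k * DF x (axis l 1))"
      by (intro continuous_intros cDF)
    have d: "((\<lambda>x. x $ k * F x) has_derivative (\<lambda>v. x $ k * DF x v + v $ k * F x)) (at x)" for x
      by (rule has_derivative_mult[OF bounded_linear.has_derivative[OF bounded_linear_vec_nth has_derivative_ident] F])
    show "(LINT x:cball 0 3|lborel. x $ k * DF x (axis l 1)) = 0"
    proof -
      have "axis l 1 $ k = (0 :: real)" using that by (simp add: axis_def)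
      then show ?thesis
        using integral_directional_derivative_zero[OF d, of "axis l 1"] c F0 by (simp add: norm_axis_1)
    qed
    show "set_integrable lborel (cball 0 3) (\<lambda>x. x $ k * DF x (axis l 1))"
      by (rule set_integrable_compact_continuous[OF compact_cball continuous_on_subset[OF c subset_UNIV]])
  qed
  have "indicator annulus x *\<^sub>R (bump x * Dg (sgn x) (rotgen i j (sgn x))) =
      indicator (cball 0 3) x *\<^sub>R (x $ i * DF x (axis j 1) - x $ j * DF x (axis i 1))" for x
  proof (cases "x \<in> annulus")
    case True
    then have x: "x \<noteq> 0" "norm (sgn x) = 1" "x \<in> cball 0 3"
      using sgn_annulus annulus_nonzero by (auto simp: annulus_def)
    interpret linear "DF x" by (rule has_derivative_linear[OF F])
    have "x $ i * DF x (axis j 1) - x $ j * DF x (axis i 1) = DF x (rotgen i j x)"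
      by (simp add: rotgen_def diff scaleR)
    also have "\<dots> = bump x * Dg (sgn x) (rotgen i j x /\<^sub>R norm x)"
      using x by (simp add: DF_def sgn_deriv_def bump_deriv_def inner_rotgen)
    also have "rotgen i j x /\<^sub>R norm x = rotgen i j (sgn x)"
      by (simp add: sgn_div_norm linear_scale[OF linear_rotgen])
    finally show ?thesis using True x by simp
  next
    case False
    then have "bump x = 0" by (auto simp: annulus_def bump_eq_0_iff)
    then have "DF x v = 0" for v by (auto simp: DF_def bump_deriv_def bump_def)
    with \<open>bump x = 0\<close> show ?thesis by simp
  qed
  then have "sphere_mean (\<lambda>\<omega>. Dg \<omega> (rotgen i j \<omega>)) =
      (LINT x:cball 0 3|lborel. x $ i * DF x (axis j 1) - x $ j * DF x (axis i 1))"
    by (simp only: sphere_mean_def set_lebesgue_integral_def)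
  also have "\<dots> = 0"
    using False part[of i j] part[of j i] I[of i j] I[of j i] by (simp add: set_integral_diff)
  finally show ?thesis .
qed

subsection \<open>Polynomials on the sphere\<close>

text \<open>Monomials are indexed by lists of coordinates: the degree is the length, and
  multiplication by a coordinate is \<open>#\<close>. Permuted lists give the same monomial, so the
  family of one degree is a finite spanning family with repetitions.\<close>

definition cmono :: "'n::finite list \<Rightarrow> real^'n \<Rightarrow> real" where
  "cmono l x = prod_list (map (($) x) l)"

inductive hom_poly :: "nat \<Rightarrow> (real^'n::finite \<Rightarrow> real) \<Rightarrow> bool" for k where
  cmono: "length l = k \<Longrightarrow> hom_poly k (cmono l)"
| zero: "hom_poly k (\<lambda>_. 0)"
| add: "hom_poly k f \<Longrightarrow> hom_poly k g \<Longrightarrow> hom_poly k (\<lambda>x. f x + g x)"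
| scale: "hom_poly k f \<Longrightarrow> hom_poly k (\<lambda>x. c * f x)"

lemma cmono_Nil: "cmono [] x = 1" and cmono_Cons: "cmono (a # l) x = x $ a * cmono l x"
  by (simp_all add: cmono_def)

lemma continuous_on_cmono: "continuous_on S (cmono l)"
  by (induction l) (auto simp: cmono_Nil[abs_def] cmono_Cons[abs_def] intro!: continuous_intros)

lemma hom_poly_mult_coord: "hom_poly k f \<Longrightarrow> hom_poly (Suc k) (\<lambda>x. x $ a * f x)"
proof (induction rule: hom_poly.induct)
  case (cmono l)
  then show ?case using hom_poly.cmono[of "a # l" "Suc k"] by (simp add: cmono_Cons[abs_def])
next
  case zero
  show ?case using hom_poly.zero by simp
next
  case (add f g)
  then show ?case using hom_poly.add[OF add.IH] by (simp add: distrib_left)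
next
  case (scale f c)
  then show ?case using hom_poly.scale[OF scale.IH] by (simp add: mult.left_commute)
qed

text \<open>By the product rule the rotation generator replaces one factor x_a by x_i if a = j and
  by - x_j if a = i, so the degree is kept. This closes the moment system within one degree.
  Regularity of \<open>D\<close> is part of the conclusion because integration by parts needs
  it.\<close>

lemma hom_poly_rotgen_deriv:
  assumes "hom_poly k f"
  shows "\<exists>D. (\<forall>x. (f has_derivative D x) (at x)) \<and> (\<forall>v. continuous_on UNIV (\<lambda>x. D x v)) \<and>
    hom_poly k (\<lambda>x. D x (rotgen i j x))"
  using assms
proof (induction rule: hom_poly.induct)
  case (cmono l)
  then show ?case
  proof (induction l arbitrary: k)
    case Nil
    then show ?case
      by (intro exI[of _ "\<lambda>x v. 0"]) (auto simp: cmono_Nil[abs_def] hom_poly.zero)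
  next
    case (Cons a l)
    obtain D where D: "\<And>x. (cmono l has_derivative D x) (at x)" "\<And>v. continuous_on UNIV (\<lambda>x. D x v)"
        "hom_poly (length l) (\<lambda>x. D x (rotgen i j x))"
      using Cons.IH[OF refl] by blast
    let ?D = "\<lambda>x v. x $ a * D x v + v $ a * cmono l x"
    have 1: "(cmono (a # l) has_derivative ?D x) (at x)" for x
      unfolding cmono_Cons[abs_def]
      by (rule has_derivative_mult[OF bounded_linear.has_derivative[OF bounded_linear_vec_nth has_derivative_ident] D(1)])
    have 2: "continuous_on UNIV (\<lambda>x. ?D x v)" for v
      by (intro continuous_intros D(2) continuous_on_cmono)
    have "?D x (rotgen i j x) = x $ a * D x (rotgen i j x) +
        ((if a = j then 1 else 0) * cmono (i # l) x + (if a = i then -1 else 0) * cmono (j # l) x)" for x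
      by (simp add: rotgen_def axis_def cmono_Cons)
    moreover have "hom_poly (length (a # l)) (\<lambda>x. x $ a * D x (rotgen i j x) +
        ((if a = j then 1 else 0) * cmono (i # l) x + (if a = i then -1 else 0) * cmono (j # l) x))"
      using hom_poly_mult_coord[OF D(3)] by (intro hom_poly.add hom_poly.scale hom_poly.cmono) auto
    ultimately have "hom_poly (length (a # l)) (\<lambda>x. ?D x (rotgen i j x))" by simp
    with 1 2 Cons.prems show ?case by (intro exI[of _ ?D]) auto
  qed
next
  case zero
  show ?case by (intro exI[of _ "\<lambda>x v. 0"]) (auto simp: hom_poly.zero)
next
  case (add f g)
  obtain D E where D: "\<And>x. (f has_derivative D x) (at x)" "\<And>v. continuous_on UNIV (\<lambda>x. D x v)"
      "hom_poly k (\<lambda>x. D x (rotgen i j x))"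
    and E: "\<And>x. (g has_derivative E x) (at x)" "\<And>v. continuous_on UNIV (\<lambda>x. E x v)"
      "hom_poly k (\<lambda>x. E x (rotgen i j x))"
    using add.IH by blast
  show ?case
    by (rule exI[of _ "\<lambda>x v. D x v + E x v"])
      (intro conjI allI has_derivative_add continuous_on_add hom_poly.add D E)
next
  case (scale f c)
  obtain D where D: "\<And>x. (f has_derivative D x) (at x)" "\<And>v. continuous_on UNIV (\<lambda>x. D x v)"
      "hom_poly k (\<lambda>x. D x (rotgen i j x))"
    using scale.IH by blast
  show ?case
    by (rule exI[of _ "\<lambda>x v. c * D x v"])
      (intro conjI allI has_derivative_mult_right continuous_on_mult_left hom_poly.scale D)
qed

lemma continuous_on_hom_poly: "hom_poly k f \<Longrightarrow> continuous_on S f"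
  by (induction rule: hom_poly.induct) (auto intro!: continuous_intros continuous_on_cmono)

lemma finite_lists_of_length: "finite {l :: 'n::finite list. length l = k}"
  using finite_lists_length_eq[of "UNIV :: 'n set" k] by simp

lemma hom_poly_expansion:
  assumes "hom_poly k f"
  shows "\<exists>c. f = (\<lambda>x. \<Sum>l | length l = k. c l * cmono l x)"
  using assms
proof (induction rule: hom_poly.induct)
  case (cmono l)
  have "cmono l x = (\<Sum>m | length m = k. (if m = l then 1 else 0) * cmono m x)" for x
    using cmono by (simp add: if_distrib[of "\<lambda>c. c * _"] sum.delta[OF finite_lists_of_length] cong: if_cong)
  then show ?case by (intro exI[of _ "\<lambda>m. if m = l then 1 else 0"] ext)
next
  case zero
  show ?case by (intro exI[of _ "\<lambda>_. 0"]) simp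
next
  case (add f g)
  then obtain c d where "f = (\<lambda>x. \<Sum>l | length l = k. c l * cmono l x)" "g = (\<lambda>x. \<Sum>l | length l = k. d l * cmono l x)"
    by blast
  then show ?case
    by (intro exI[of _ "\<lambda>l. c l + d l"]) (simp add: distrib_right sum.distrib)
next
  case (scale f c)
  then obtain d where "f = (\<lambda>x. \<Sum>l | length l = k. d l * cmono l x)"
    by blast
  then show ?case
    by (intro exI[of _ "\<lambda>l. c * d l"]) (simp add: sum_distrib_left mult.assoc)
qed

text \<open>Induction on the polynomial. The list \<open>l\<close> stays arbitrary so that a linear
  factor can be absorbed into the monomial, and the extra factor \<open>q\<close> makes the product
  case work: the first factor is handled with \<open>q\<close>, and its product with
  \<open>q\<close> is then the new \<open>q\<close> for the second.\<close>

lemma sphere_mean_mult_polynomial: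
  fixes g :: "real^'n::finite \<Rightarrow> real"
  assumes p: "real_polynomial_function p" and g: "continuous_on (sphere 0 1) g"
    and q: "continuous_on (sphere 0 1) q" "\<And>l. sphere_mean (\<lambda>\<omega>. g \<omega> * cmono l \<omega> * q \<omega>) = 0"
  shows "sphere_mean (\<lambda>\<omega>. g \<omega> * cmono l \<omega> * (q \<omega> * p \<omega>)) = 0"
  using p q
proof (induction arbitrary: q l)
  case (linear f)
  interpret bounded_linear f by fact
  have "g \<omega> * cmono l \<omega> * (q \<omega> * f \<omega>) = (\<Sum>k\<in>UNIV. f (axis k 1) * (g \<omega> * cmono (k # l) \<omega> * q \<omega>))" for \<omega>
  proof -
    have "f \<omega> = (\<Sum>k\<in>UNIV. \<omega> $ k * f (axis k 1))"
      by (subst basis_expansion[symmetric, of \<omega>]) (simp add: sum scaleR scalar_mult_eq_scaleR)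
    show ?thesis by (subst \<open>f \<omega> = _\<close>) (simp add: sum_distrib_left cmono_Cons mult_ac)
  qed
  then have "sphere_mean (\<lambda>\<omega>. g \<omega> * cmono l \<omega> * (q \<omega> * f \<omega>)) =
      sphere_mean (\<lambda>\<omega>. \<Sum>k\<in>UNIV. f (axis k 1) * (g \<omega> * cmono (k # l) \<omega> * q \<omega>))" by simp
  also have "\<dots> = (\<Sum>k\<in>UNIV. sphere_mean (\<lambda>\<omega>. f (axis k 1) * (g \<omega> * cmono (k # l) \<omega> * q \<omega>)))"
    by (intro sphere_mean_sum finite continuous_intros g linear.prems continuous_on_cmono)
  finally have "sphere_mean (\<lambda>\<omega>. g \<omega> * cmono l \<omega> * (q \<omega> * f \<omega>)) =
      (\<Sum>k\<in>UNIV. sphere_mean (\<lambda>\<omega>. f (axis k 1) * (g \<omega> * cmono (k # l) \<omega> * q \<omega>)))" .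
  then show ?case by (simp add: sphere_mean_cmult linear.prems)
next
  case (const c)
  then show ?case
    using sphere_mean_cmult[of c "\<lambda>\<omega>. g \<omega> * cmono l \<omega> * q \<omega>"] by (simp add: mult_ac)
next
  case (add f h)
  have c: "continuous_on (sphere 0 1) f" "continuous_on (sphere 0 1) h"
    using add.hyps continuous_on_polymonial_function by (auto simp: real_polynomial_function_eq)
  have "sphere_mean (\<lambda>\<omega>. g \<omega> * cmono l \<omega> * (q \<omega> * f \<omega>) + g \<omega> * cmono l \<omega> * (q \<omega> * h \<omega>)) = 0"
    by (subst sphere_mean_add)
      (simp_all add: add.IH add.prems c g continuous_on_cmono continuous_on_mult)
  then show ?case by (simp add: distrib_left)
next
  case (mult f h)
  have c: "continuous_on (sphere 0 1) f"
    using mult.hyps continuous_on_polymonial_function by (auto simp: real_polynomial_function_eq)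
  have "sphere_mean (\<lambda>\<omega>. g \<omega> * cmono l \<omega> * (q \<omega> * f \<omega> * h \<omega>)) = 0"
    by (intro mult.IH(2) continuous_on_mult mult.prems c mult.IH(1))
  then show ?case by (simp add: mult.assoc)
qed

text \<open>By Stone-Weierstrass g is uniformly within d of a polynomial p. Since g is orthogonal to
  p, the mean of g^2 is the mean of g (g - p), at most d times the mean of |g|.\<close>

lemma sphere_mean_cmono_complete:
  fixes g :: "real^'n::finite \<Rightarrow> real"
  assumes g: "continuous_on (sphere 0 1) g" and 0: "\<And>l. sphere_mean (\<lambda>\<omega>. g \<omega> * cmono l \<omega>) = 0"
    and \<omega>: "norm \<omega> = 1"
  shows "g \<omega> = 0"
proof -
  have gg: "continuous_on (sphere 0 1) (\<lambda>\<omega>. g \<omega> * g \<omega>)" by (intro continuous_intros g)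
  have ag: "continuous_on (sphere 0 1) (\<lambda>\<omega>. \<bar>g \<omega>\<bar>)" by (intro continuous_intros g)
  define C where "C = sphere_mean (\<lambda>\<omega>. \<bar>g \<omega>\<bar>)"
  have "C \<ge> sphere_mean (\<lambda>\<omega> :: real^'n. 0)"
    unfolding C_def by (intro sphere_mean_mono ag) auto
  then have C: "C \<ge> 0" by (simp add: sphere_mean_def)
  have "sphere_mean (\<lambda>\<omega>. g \<omega> * g \<omega>) \<le> 0 + e" if "e > 0" for e
  proof -
    \<comment> \<open>The added 1 keeps the quotient meaningful when \<open>C = 0\<close> and still
      gives \<open>d * C \<le> e\<close>.\<close>
    define d where "d = e / (C + 1)"
    have d: "d > 0" "d * C \<le> e" using C that by (auto simp: d_def field_simps)
    obtain p where p: "real_polynomial_function p" "\<And>x. x \<in> sphere 0 1 \<Longrightarrow> \<bar>g x - p x\<bar> < d"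
      using Stone_Weierstrass_real_polynomial_function[OF compact_sphere g d(1)] by blast
    have cp: "continuous_on (sphere 0 1) p"
      using p continuous_on_polymonial_function by (auto simp: real_polynomial_function_eq)
    have "sphere_mean (\<lambda>\<omega>. g \<omega> * cmono [] \<omega> * (1 * p \<omega>)) = 0"
      by (rule sphere_mean_mult_polynomial[OF p(1) g]) (simp_all add: 0)
    then have gp: "sphere_mean (\<lambda>\<omega>. g \<omega> * p \<omega>) = 0" by (simp add: cmono_Nil)
    have "sphere_mean (\<lambda>\<omega>. g \<omega> * g \<omega>) = sphere_mean (\<lambda>\<omega>. g \<omega> * p \<omega> + g \<omega> * (g \<omega> - p \<omega>))"
      by (simp add: algebra_simps)
    also have "\<dots> = sphere_mean (\<lambda>\<omega>. g \<omega> * p \<omega>) + sphere_mean (\<lambda>\<omega>. g \<omega> * (g \<omega> - p \<omega>))"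
      by (intro sphere_mean_add continuous_intros g cp)
    also have "sphere_mean (\<lambda>\<omega>. g \<omega> * (g \<omega> - p \<omega>)) \<le> sphere_mean (\<lambda>\<omega>. d * \<bar>g \<omega>\<bar>)"
    proof (intro sphere_mean_mono continuous_intros g cp)
      fix \<omega> :: "real^'n" assume "norm \<omega> = 1"
      then have "\<bar>g \<omega>\<bar> * \<bar>g \<omega> - p \<omega>\<bar> \<le> \<bar>g \<omega>\<bar> * d"
        using p(2)[of \<omega>] by (intro mult_left_mono) auto
      then show "g \<omega> * (g \<omega> - p \<omega>) \<le> d * \<bar>g \<omega>\<bar>"
        using abs_ge_self[of "g \<omega> * (g \<omega> - p \<omega>)"] by (simp add: abs_mult mult.commute)
    qed
    finally show ?thesis using gp d by (simp add: sphere_mean_cmult C_def)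
  qed
  then have "sphere_mean (\<lambda>\<omega>. g \<omega> * g \<omega>) \<le> 0" by (rule field_le_epsilon)
  moreover have "sphere_mean (\<lambda>\<omega>. g \<omega> * g \<omega>) \<ge> sphere_mean (\<lambda>\<omega> :: real^'n. 0)"
    by (intro sphere_mean_mono gg) auto
  ultimately have "sphere_mean (\<lambda>\<omega>. g \<omega> * g \<omega>) = 0" by (simp add: sphere_mean_def)
  from sphere_mean_eq_0D[OF gg _ this \<omega>] show ?thesis by simp
qed

subsection \<open>Polynomial moments of a solution\<close>

text \<open>The pointwise form of the identity that half the sum of the squared rotation generators
  is the spherical Laplacian. \<open>B\<close> will be the spatial Hessian and \<open>g\<close> the
  gradient, with the chain-rule factors a = r^2 and b = r; the 2 comes from summing over ordered
  pairs.\<close>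

lemma sum_rotgen_squares:
  fixes B :: "real^'n::finite \<Rightarrow> real^'n \<Rightarrow> real"
  assumes B: "bilinear B" and g: "linear g" and \<omega>: "norm \<omega> = 1"
  shows "(\<Sum>i\<in>UNIV. \<Sum>j\<in>UNIV. a * B (rotgen i j \<omega>) (rotgen i j \<omega>) + b * g (rotgen i j (rotgen i j \<omega>)))
    = 2 * a * ((\<Sum>i\<in>UNIV. B (axis i 1) (axis i 1)) - B \<omega> \<omega>) - 2 * b * (real CARD('n) - 1) * g \<omega>"
proof -
  interpret g: linear g by (rule g)
  note b = bilinear_ladd[OF B] bilinear_radd[OF B] bilinear_lmul[OF B] bilinear_rmul[OF B]
    bilinear_lsub[OF B] bilinear_rsub[OF B]
  define h where "h i j = B (axis i 1) (axis j 1)" for i j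
  define \<gamma> where "\<gamma> i = g (axis i 1)" for i
  define S where "S = (\<Sum>i\<in>UNIV. h i i)"
  define T where "T = (\<Sum>i\<in>UNIV. \<Sum>j\<in>UNIV. \<omega> $ i * \<omega> $ j * h i j)"
  define R where "R = (\<Sum>i\<in>UNIV. \<omega> $ i * \<gamma> i)"
  have one: "(\<Sum>i\<in>UNIV. \<omega> $ i * \<omega> $ i) = 1"
    using \<omega> by (simp add: norm_eq_1 inner_vec_def)
  have ex: "\<omega> = (\<Sum>i\<in>UNIV. \<omega> $ i *\<^sub>R axis i 1)"
    using basis_expansion[of \<omega>] by (simp add: scalar_mult_eq_scaleR)
  have T: "B \<omega> \<omega> = T"
  proof -
    have "B \<omega> \<omega> = B (\<Sum>i\<in>UNIV. \<omega> $ i *\<^sub>R axis i 1) (\<Sum>i\<in>UNIV. \<omega> $ i *\<^sub>R axis i 1)"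
      using ex by simp
    also have "\<dots> = T"
      by (subst bilinear_sum[OF B]) (simp add: b T_def h_def sum.cartesian_product mult.assoc mult.left_commute)
    finally show ?thesis .
  qed
  have R: "g \<omega> = R"
  proof -
    have "g \<omega> = g (\<Sum>i\<in>UNIV. \<omega> $ i *\<^sub>R axis i 1)" using ex by simp
    then show ?thesis by (simp add: g.sum g.scaleR R_def \<gamma>_def)
  qed
  have "B (rotgen i j \<omega>) (rotgen i j \<omega>) = \<omega> $ i * \<omega> $ i * h j j + \<omega> $ j * \<omega> $ j * h i i
      - \<omega> $ i * \<omega> $ j * h i j - \<omega> $ j * \<omega> $ i * h j i" for i j
    by (simp add: rotgen_def b h_def algebra_simps)
  then have "(\<Sum>i\<in>UNIV. \<Sum>j\<in>UNIV. B (rotgen i j \<omega>) (rotgen i j \<omega>)) =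
      (\<Sum>i\<in>UNIV. \<Sum>j\<in>UNIV. \<omega> $ i * \<omega> $ i * h j j) + (\<Sum>i\<in>UNIV. \<Sum>j\<in>UNIV. \<omega> $ j * \<omega> $ j * h i i)
      - T - (\<Sum>i\<in>UNIV. \<Sum>j\<in>UNIV. \<omega> $ j * \<omega> $ i * h j i)"
    by (simp add: sum.distrib sum_subtractf T_def)
  also have "(\<Sum>i\<in>UNIV. \<Sum>j\<in>UNIV. \<omega> $ i * \<omega> $ i * h j j) = S"
    by (simp add: S_def one flip: sum_product)
  also have "(\<Sum>i\<in>UNIV. \<Sum>j\<in>UNIV. \<omega> $ j * \<omega> $ j * h i i) = S"
    by (subst sum.swap) (simp add: S_def one flip: sum_product)
  also have "(\<Sum>i\<in>UNIV. \<Sum>j\<in>UNIV. \<omega> $ j * \<omega> $ i * h j i) = T"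
    unfolding T_def by (rule sum.swap)
  finally have 1: "(\<Sum>i\<in>UNIV. \<Sum>j\<in>UNIV. B (rotgen i j \<omega>) (rotgen i j \<omega>)) = 2 * (S - T)" by simp
  \<comment> \<open>Off the diagonal the squared generator is minus the projection onto the (i, j)
    plane. On the diagonal it is zero, and the \<open>if\<close> term compensates for the two
    subtracted terms.\<close>
  have "g (rotgen i j (rotgen i j \<omega>)) = (if i = j then 2 * (\<omega> $ i * \<gamma> i) else 0) - \<omega> $ j * \<gamma> j - \<omega> $ i * \<gamma> i" for i j
  proof -
    have "axis a 1 $ b = (if a = b then 1 else 0 :: real)" for a b :: 'n by (simp add: axis_def)
    then show ?thesis
      by (cases "i = j") (simp_all add: rotgen_def g.diff g.scaleR g.neg \<gamma>_def)
  qed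
  then have "(\<Sum>i\<in>UNIV. \<Sum>j\<in>UNIV. g (rotgen i j (rotgen i j \<omega>))) =
      (\<Sum>i\<in>UNIV. 2 * (\<omega> $ i * \<gamma> i) - R - real CARD('n) * (\<omega> $ i * \<gamma> i))"
    by (simp add: sum.distrib sum_subtractf R_def)
  also have "\<dots> = 2 * R - real CARD('n) * R - real CARD('n) * R"
    by (simp add: sum.distrib sum_subtractf R_def sum_distrib_left)
  finally have 2: "(\<Sum>i\<in>UNIV. \<Sum>j\<in>UNIV. g (rotgen i j (rotgen i j \<omega>))) = - 2 * (real CARD('n) - 1) * R"
    by (simp add: algebra_simps)
  have "(\<Sum>i\<in>UNIV. \<Sum>j\<in>UNIV. a * B (rotgen i j \<omega>) (rotgen i j \<omega>) + b * g (rotgen i j (rotgen i j \<omega>))) =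
      a * (\<Sum>i\<in>UNIV. \<Sum>j\<in>UNIV. B (rotgen i j \<omega>) (rotgen i j \<omega>)) + b * (\<Sum>i\<in>UNIV. \<Sum>j\<in>UNIV. g (rotgen i j (rotgen i j \<omega>)))"
    by (simp add: sum.distrib sum_distrib_left)
  then show ?thesis unfolding 1 2 T R by (simp add: S_def h_def algebra_simps)
qed

text \<open>\<open>G\<close> is the space-time gradient of \<open>u\<close> and \<open>H p\<close> the derivative of \<open>G\<close> at \<open>p\<close>.\<close>

locale wave_jet =
  fixes u :: "(real^'n::finite) \<times> real \<Rightarrow> real"
    and G :: "(real^'n) \<times> real \<Rightarrow> (real^'n) \<times> real"
    and H :: "(real^'n) \<times> real \<Rightarrow> (real^'n) \<times> real \<Rightarrow> (real^'n) \<times> real"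
  assumes du: "t \<ge> 0 \<Longrightarrow> (u has_derivative (\<lambda>h. G (x, t) \<bullet> h)) (at (x, t) within closed_half)"
    and cG: "continuous_on closed_half G"
    and dG: "t > 0 \<Longrightarrow> (G has_derivative H (x, t)) (at (x, t))"
    and cH: "continuous_on open_half (\<lambda>p. H p v)"
    and wave: "t > 0 \<Longrightarrow>
      H (x, t) (0, 1) \<bullet> (0, 1) = (\<Sum>i\<in>UNIV. H (x, t) (axis i 1, 0) \<bullet> (axis i 1, 0))"
begin

lemma du_interior: "t > 0 \<Longrightarrow> (u has_derivative (\<lambda>h. G (x, t) \<bullet> h)) (at (x, t))"
proof -
  assume "t > 0"
  then have "(u has_derivative (\<lambda>h. G (x, t) \<bullet> h)) (at (x, t) within open_half)"
    by (intro has_derivative_subset[OF du]) auto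
  then show ?thesis using \<open>t > 0\<close>
    by (simp add: at_within_open[of _ open_half] open_Times)
qed

lemma cu: "continuous_on closed_half u"
  unfolding continuous_on_eq_continuous_within
proof
  fix p :: "(real^'n) \<times> real" assume "p \<in> closed_half"
  then have "snd p \<ge> 0" by (simp add: mem_Times_iff)
  from has_derivative_continuous[OF du[OF this, of "fst p"]]
  show "continuous (at p within closed_half) u" by simp
qed

lemma linear_H: "t > 0 \<Longrightarrow> linear (H (x, t))"
  by (rule has_derivative_linear[OF dG])

lemma H_symmetric: "t > 0 \<Longrightarrow> H (x, t) v \<bullet> w = H (x, t) w \<bullet> v"
  by (rule gradient_derivative_symmetric[OF _ _ _ dG, of open_half])
    (auto intro: open_Times du_interior)

lemma H_expand:
  assumes "t > 0"
  shows "H (x, t) (y, s) = (\<Sum>k\<in>UNIV. y $ k *\<^sub>R H (x, t) (axis k 1, 0)) + s *\<^sub>R H (x, t) (0, 1)"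
proof -
  interpret linear "H (x, t)" by (rule linear_H[OF assms])
  have "(y, s) = (\<Sum>k\<in>UNIV. y $ k *\<^sub>R (axis k 1, 0)) + s *\<^sub>R (0, 1)"
    using basis_expansion[of y] by (simp add: prod_eq_iff fst_sum snd_sum scalar_mult_eq_scaleR)
  then show ?thesis by (simp only: add sum scaleR)
qed

text \<open>\<open>cH\<close> concerns a fixed direction. Linearity moves a varying direction into
  scalar coefficients, which gives joint continuity.\<close>

lemma continuous_on_H_compose:
  assumes "continuous_on S x" "continuous_on S t" "continuous_on S y" "continuous_on S s"
    and "\<And>z. z \<in> S \<Longrightarrow> t z > 0"
  shows "continuous_on S (\<lambda>z. H (x z, t z) (y z, s z))"
proof -
  have c: "continuous_on S (\<lambda>z. H (x z, t z) v)" for v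
    by (rule continuous_on_compose2[OF cH]) (use assms in \<open>auto intro!: continuous_intros\<close>)
  have "continuous_on S (\<lambda>z. (\<Sum>k\<in>UNIV. y z $ k *\<^sub>R H (x z, t z) (axis k 1, 0)) + s z *\<^sub>R H (x z, t z) (0, 1))"
    by (intro continuous_intros c assms)
  then show ?thesis
    by (rule continuous_on_eq) (rule H_expand[symmetric, OF assms(5)])
qed

lemma continuous_on_G_compose:
  assumes "continuous_on S x" "continuous_on S t" "\<And>z. z \<in> S \<Longrightarrow> t z \<ge> 0"
  shows "continuous_on S (\<lambda>z. G (x z, t z))"
  by (rule continuous_on_compose2[OF cG]) (use assms in \<open>auto intro!: continuous_intros\<close>)

lemma continuous_on_u_compose:
  assumes "continuous_on S x" "continuous_on S t" "\<And>z. z \<in> S \<Longrightarrow> t z \<ge> 0"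
  shows "continuous_on S (\<lambda>z. u (x z, t z))"
  by (rule continuous_on_compose2[OF cu]) (use assms in \<open>auto intro!: continuous_intros\<close>)

text \<open>
  With \<open>p = (r, t)\<close>: the moments of \<open>u\<close>, \<open>u\<^sub>r\<close>, \<open>u\<^sub>t\<close> and \<open>u\<^sub>t\<^sub>t - u\<^sub>r\<^sub>r\<close> on the sphere of radius \<open>r\<close>.
\<close>

definition mu :: "(real^'n \<Rightarrow> real) \<Rightarrow> real \<times> real \<Rightarrow> real" where
  "mu Y p = sphere_mean (\<lambda>\<omega>. u (fst p *\<^sub>R \<omega>, snd p) * Y \<omega>)"

definition mr :: "(real^'n \<Rightarrow> real) \<Rightarrow> real \<times> real \<Rightarrow> real" where
  "mr Y p = sphere_mean (\<lambda>\<omega>. (G (fst p *\<^sub>R \<omega>, snd p) \<bullet> (\<omega>, 0)) * Y \<omega>)"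

definition mt :: "(real^'n \<Rightarrow> real) \<Rightarrow> real \<times> real \<Rightarrow> real" where
  "mt Y p = sphere_mean (\<lambda>\<omega>. (G (fst p *\<^sub>R \<omega>, snd p) \<bullet> (0, 1)) * Y \<omega>)"

definition mf :: "(real^'n \<Rightarrow> real) \<Rightarrow> real \<times> real \<Rightarrow> real" where
  "mf Y p = sphere_mean (\<lambda>\<omega>. (H (fst p *\<^sub>R \<omega>, snd p) (0, 1) \<bullet> (0, 1)
      - H (fst p *\<^sub>R \<omega>, snd p) (\<omega>, 0) \<bullet> (\<omega>, 0)) * Y \<omega>)"

section \<open>Derivatives of the moments along lines in the (r, t) plane\<close>

context
  fixes Y :: "real^'n \<Rightarrow> real"
  assumes Y: "continuous_on UNIV Y"
begin

lemma Y_compose: "continuous_on S f \<Longrightarrow> continuous_on S (\<lambda>z. Y (f z))"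
  by (rule continuous_on_compose2[OF Y]) auto

lemma continuous_on_moments:
  "continuous_on (UNIV \<times> {0..}) (mu Y)" "continuous_on (UNIV \<times> {0..}) (mr Y)"
  "continuous_on (UNIV \<times> {0..}) (mt Y)"
  unfolding mu_def[abs_def] mr_def[abs_def] mt_def[abs_def]
  by (rule continuous_on_sphere_mean, unfold case_prod_beta,
      intro continuous_intros continuous_on_G_compose continuous_on_u_compose Y_compose, auto)+

lemma continuous_on_slices_G:
  "t \<ge> 0 \<Longrightarrow> continuous_on S (\<lambda>\<omega>. u (r *\<^sub>R \<omega>, t))"
  "t \<ge> 0 \<Longrightarrow> continuous_on S (\<lambda>\<omega>. G (r *\<^sub>R \<omega>, t))"
  by (intro continuous_intros continuous_on_G_compose continuous_on_u_compose; simp)+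

lemma has_real_derivative_mu:
  assumes "t > 0"
  shows "((\<lambda>h. mu Y (r + \<alpha> * h, t + \<beta> * h)) has_real_derivative \<alpha> * mr Y (r, t) + \<beta> * mt Y (r, t)) (at 0)"
proof -
  let ?f' = "\<lambda>h \<omega>. (G ((r + \<alpha> * h) *\<^sub>R \<omega>, t + \<beta> * h) \<bullet> (\<alpha> *\<^sub>R \<omega>, \<beta>)) * Y \<omega>"
  let ?J = "{h. 0 < t + \<beta> * h}"
  have "((\<lambda>h. sphere_mean (\<lambda>\<omega>. u ((r + \<alpha> * h) *\<^sub>R \<omega>, t + \<beta> * h) * Y \<omega>)) has_real_derivative
      sphere_mean (?f' 0)) (at 0)"
  proof (rule has_real_derivative_sphere_mean)
    show "open ?J" by (intro open_Collect_less continuous_intros)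
    show "0 \<in> ?J" using assms by simp
    show "continuous_on (sphere 0 1) (\<lambda>\<omega>. u ((r + \<alpha> * h) *\<^sub>R \<omega>, t + \<beta> * h) * Y \<omega>)" if "h \<in> ?J" for h
      using that by (intro continuous_on_mult continuous_on_slices_G Y_compose continuous_on_id) auto
    show "((\<lambda>h. u ((r + \<alpha> * h) *\<^sub>R \<omega>, t + \<beta> * h) * Y \<omega>) has_real_derivative ?f' h \<omega>) (at h)"
      if "h \<in> ?J" for h \<omega>
    proof (rule DERIV_cmult_right)
      have "((\<lambda>h. ((r + \<alpha> * h) *\<^sub>R \<omega>, t + \<beta> * h)) has_derivative (\<lambda>k. k *\<^sub>R (\<alpha> *\<^sub>R \<omega>, \<beta>))) (at h)"
        by (auto intro!: derivative_eq_intros simp: mult.commute)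
      from has_derivative_compose[OF this du_interior[of "t + \<beta> * h" "(r + \<alpha> * h) *\<^sub>R \<omega>"]] that
      show "((\<lambda>h. u ((r + \<alpha> * h) *\<^sub>R \<omega>, t + \<beta> * h)) has_real_derivative
          G ((r + \<alpha> * h) *\<^sub>R \<omega>, t + \<beta> * h) \<bullet> (\<alpha> *\<^sub>R \<omega>, \<beta>)) (at h)"
        by (simp add: has_field_derivative_def mult_commute_abs del: scaleR_Pair)
    qed
    show "continuous_on (?J \<times> sphere 0 1) (\<lambda>(h, \<omega>). ?f' h \<omega>)"
      unfolding case_prod_beta
      by (intro continuous_intros continuous_on_G_compose Y_compose) auto
  qed
  also have "sphere_mean (?f' 0) = sphere_mean (\<lambda>\<omega>. \<alpha> * ((G (r *\<^sub>R \<omega>, t) \<bullet> (\<omega>, 0)) * Y \<omega>)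
      + \<beta> * ((G (r *\<^sub>R \<omega>, t) \<bullet> (0, 1)) * Y \<omega>))"
    by (simp add: inner_prod_def algebra_simps)
  also have "\<dots> = \<alpha> * mr Y (r, t) + \<beta> * mt Y (r, t)"
    by (subst sphere_mean_add)
      (use assms in \<open>auto intro!: continuous_intros continuous_on_slices_G Y_compose
         simp: sphere_mean_cmult mr_def mt_def\<close>)
  finally show ?thesis by (simp add: mu_def)
qed

text \<open>Along a characteristic the mixed second derivatives of \<open>u\<close> cancel.\<close>

lemma has_real_derivative_characteristic:
  assumes "t > 0" and \<kappa>: "\<kappa> * \<kappa> = 1"
  shows "((\<lambda>h. \<kappa> * mr Y (r - \<kappa> * \<beta> * h, t + \<beta> * h) + mt Y (r - \<kappa> * \<beta> * h, t + \<beta> * h))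
    has_real_derivative \<beta> * mf Y (r, t)) (at 0)"
proof -
  let ?p = "\<lambda>h \<omega>. ((r - \<kappa> * \<beta> * h) *\<^sub>R \<omega>, t + \<beta> * h)"
  let ?f = "\<lambda>h \<omega>. (G (?p h \<omega>) \<bullet> (\<kappa> *\<^sub>R \<omega>, 1)) * Y \<omega>"
  let ?f' = "\<lambda>h \<omega>. (H (?p h \<omega>) (- (\<kappa> * \<beta>) *\<^sub>R \<omega>, \<beta>) \<bullet> (\<kappa> *\<^sub>R \<omega>, 1)) * Y \<omega>"
  let ?J = "{h. 0 < t + \<beta> * h}"
  have "((\<lambda>h. sphere_mean (?f h)) has_real_derivative sphere_mean (?f' 0)) (at 0)"
  proof (rule has_real_derivative_sphere_mean)
    show "open ?J" by (intro open_Collect_less continuous_intros)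
    show "0 \<in> ?J" using assms by simp
    show "continuous_on (sphere 0 1) (?f h)" if "h \<in> ?J" for h
      using that by (intro continuous_on_mult continuous_on_inner continuous_intros continuous_on_slices_G Y_compose) auto
    show "((\<lambda>h. ?f h \<omega>) has_real_derivative ?f' h \<omega>) (at h)" if "h \<in> ?J" for h \<omega>
    proof (rule DERIV_cmult_right)
      have "((\<lambda>h. ?p h \<omega>) has_derivative (\<lambda>k. k *\<^sub>R (- (\<kappa> * \<beta>) *\<^sub>R \<omega>, \<beta>))) (at h)"
        by (auto intro!: derivative_eq_intros simp: mult.commute)
      from has_derivative_inner_left[OF has_derivative_compose[OF this dG[of "t + \<beta> * h" "(r - \<kappa> * \<beta> * h) *\<^sub>R \<omega>"]]]
        that linear_scale[OF linear_H[of "t + \<beta> * h" "(r - \<kappa> * \<beta> * h) *\<^sub>R \<omega>"]]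
      show "((\<lambda>h. G (?p h \<omega>) \<bullet> (\<kappa> *\<^sub>R \<omega>, 1)) has_real_derivative
          H (?p h \<omega>) (- (\<kappa> * \<beta>) *\<^sub>R \<omega>, \<beta>) \<bullet> (\<kappa> *\<^sub>R \<omega>, 1)) (at h)"
        by (simp add: has_field_derivative_def mult_commute_abs del: scaleR_Pair)
    qed
    show "continuous_on (?J \<times> sphere 0 1) (\<lambda>(h, \<omega>). ?f' h \<omega>)"
      unfolding case_prod_beta
      by (intro continuous_intros continuous_on_H_compose Y_compose) auto
  qed
  also have "sphere_mean (?f' 0) = sphere_mean (\<lambda>\<omega>. \<beta> * ((H (r *\<^sub>R \<omega>, t) (0, 1) \<bullet> (0, 1)
      - H (r *\<^sub>R \<omega>, t) (\<omega>, 0) \<bullet> (\<omega>, 0)) * Y \<omega>))"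
  proof (rule sphere_mean_cong)
    fix \<omega> :: "real^'n"
    interpret linear "H (r *\<^sub>R \<omega>, t)" by (rule linear_H[OF \<open>t > 0\<close>])
    have e: "(a *\<^sub>R \<omega>, b) = a *\<^sub>R (\<omega>, 0) + b *\<^sub>R (0, 1)" for a b :: real by simp
    have "H (r *\<^sub>R \<omega>, t) (- (\<kappa> * \<beta>) *\<^sub>R \<omega>, \<beta>) \<bullet> (\<kappa> *\<^sub>R \<omega>, 1) =
        \<beta> * (H (r *\<^sub>R \<omega>, t) (0, 1) \<bullet> (0, 1)) - (\<kappa> * \<kappa>) * \<beta> * (H (r *\<^sub>R \<omega>, t) (\<omega>, 0) \<bullet> (\<omega>, 0))
        - \<kappa> * \<beta> * (H (r *\<^sub>R \<omega>, t) (\<omega>, 0) \<bullet> (0, 1)) + \<kappa> * \<beta> * (H (r *\<^sub>R \<omega>, t) (0, 1) \<bullet> (\<omega>, 0))"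
      unfolding e[of "- (\<kappa> * \<beta>)"] e[of \<kappa> 1] add scaleR inner_add_left inner_add_right inner_scaleR_left inner_scaleR_right
      by (simp add: algebra_simps)
    also have "\<dots> = \<beta> * (H (r *\<^sub>R \<omega>, t) (0, 1) \<bullet> (0, 1) - H (r *\<^sub>R \<omega>, t) (\<omega>, 0) \<bullet> (\<omega>, 0))"
      using H_symmetric[OF \<open>t > 0\<close>, of _ "(\<omega>, 0)" "(0, 1)"] by (simp add: \<kappa> right_diff_distrib)
    finally show "?f' 0 \<omega> = \<beta> * ((H (r *\<^sub>R \<omega>, t) (0, 1) \<bullet> (0, 1)
      - H (r *\<^sub>R \<omega>, t) (\<omega>, 0) \<bullet> (\<omega>, 0)) * Y \<omega>)" by simp
  qed
  also have "\<dots> = \<beta> * mf Y (r, t)" by (simp add: sphere_mean_cmult mf_def)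
  finally have 1: "((\<lambda>h. sphere_mean (?f h)) has_real_derivative \<beta> * mf Y (r, t)) (at 0)" .
  show ?thesis
  \<comment> \<open>Splitting the mean into \<open>mr\<close> and \<open>mt\<close> uses continuity
    of both integrands, known for nonnegative times. The two functions of h are therefore compared
    only on \<open>?J\<close>.\<close>
  proof (rule has_field_derivative_transform_within_open[OF 1])
    show "open ?J" by (intro open_Collect_less continuous_intros)
    show "0 \<in> ?J" using assms by simp
    fix h assume h: "h \<in> ?J"
    have "sphere_mean (?f h) = sphere_mean (\<lambda>\<omega>. \<kappa> * ((G (?p h \<omega>) \<bullet> (\<omega>, 0)) * Y \<omega>) + (G (?p h \<omega>) \<bullet> (0, 1)) * Y \<omega>)"
      by (simp add: inner_prod_def algebra_simps)
    also have "\<dots> = \<kappa> * mr Y (r - \<kappa> * \<beta> * h, t + \<beta> * h) + mt Y (r - \<kappa> * \<beta> * h, t + \<beta> * h)"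
      by (subst sphere_mean_add)
        (use h in \<open>auto intro!: continuous_intros continuous_on_slices_G Y_compose
           simp: sphere_mean_cmult mr_def mt_def\<close>)
    finally show "sphere_mean (?f h) = \<kappa> * mr Y (r - \<kappa> * \<beta> * h, t + \<beta> * h) + mt Y (r - \<kappa> * \<beta> * h, t + \<beta> * h)" .
  qed
qed

end

text \<open>The bracket is the square of the rotation generator J applied to \<omega> \<mapsto> u (r
  \<omega>, t), by the chain rule. As J is antisymmetric under the mean, two integrations by parts
  move J^2 onto \<open>Y\<close>, so that \<open>Z\<close> is J^2 Y, again of degree
  \<open>k\<close>.\<close>

lemma mean_rotgen_squares:
  assumes Y: "hom_poly k Y"
  shows "\<exists>Z. hom_poly k Z \<and> (\<forall>r t. t > 0 \<longrightarrow>
    sphere_mean (\<lambda>\<omega>. (r\<^sup>2 * (H (r *\<^sub>R \<omega>, t) (rotgen i j \<omega>, 0) \<bullet> (rotgen i j \<omega>, 0))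
      + r * (G (r *\<^sub>R \<omega>, t) \<bullet> (rotgen i j (rotgen i j \<omega>), 0))) * Y \<omega>) = mu Z (r, t))"
proof -
  let ?J = "rotgen i j :: real^'n \<Rightarrow> real^'n"
  obtain D where D: "\<And>x. (Y has_derivative D x) (at x)" "\<And>v. continuous_on UNIV (\<lambda>x. D x v)"
      and Y1: "hom_poly k (\<lambda>x. D x (?J x))"
    using hom_poly_rotgen_deriv[OF Y, of i j] by blast
  define Y1 where "Y1 = (\<lambda>x. D x (?J x))"
  obtain E where E: "\<And>x. (Y1 has_derivative E x) (at x)" "\<And>v. continuous_on UNIV (\<lambda>x. E x v)"
      and Z: "hom_poly k (\<lambda>x. E x (?J x))"
    using hom_poly_rotgen_deriv[OF Y1, of i j] unfolding Y1_def by blast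
  have cY: "continuous_on S Y" "continuous_on S Y1" "continuous_on S (\<lambda>x. E x (?J x))" for S
    using Y Y1 Z by (auto simp: Y1_def intro: continuous_on_hom_poly)
  have cD: "continuous_on S (\<lambda>x. D x v)" "continuous_on S (\<lambda>x. E x v)" for S v
    by (rule continuous_on_subset[OF D(2)] continuous_on_subset[OF E(2)]; simp)+
  have blJ: "bounded_linear ?J" using linear_rotgen by (simp add: linear_conv_bounded_linear)
  have cJ: "continuous_on S ?J" for S by (rule linear_continuous_on[OF blJ])
  have cJJ: "continuous_on S (\<lambda>x. ?J (?J x))" for S
    by (rule continuous_on_compose2[OF cJ[of UNIV] cJ]) auto
  have dJ: "((\<lambda>x. (?J x, 0::real)) has_derivative (\<lambda>v. (?J v, 0))) (at \<omega>)" for \<omega>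
    by (intro has_derivative_Pair has_derivative_const bounded_linear_imp_has_derivative[OF blJ])
  have "sphere_mean (\<lambda>\<omega>. (r\<^sup>2 * (H (r *\<^sub>R \<omega>, t) (?J \<omega>, 0) \<bullet> (?J \<omega>, 0))
      + r * (G (r *\<^sub>R \<omega>, t) \<bullet> (?J (?J \<omega>), 0))) * Y \<omega>) = mu (\<lambda>x. E x (?J x)) (r, t)"
    if t: "t > 0" for r t
  proof -
    let ?p = "\<lambda>\<omega> :: real^'n. (r *\<^sub>R \<omega>, t)"
    have dp: "(?p has_derivative (\<lambda>v. (r *\<^sub>R v, 0))) (at \<omega>)" for \<omega>
      by (auto intro!: derivative_eq_intros)
    \<comment> \<open>\<open>?I1\<close> is J applied to (G \<bullet> J \<omega>) Y, and
      \<open>?I2\<close> is J applied to u (J Y). Both have mean zero, and r times the first minus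
      the second, plus u J^2 Y, is the required integrand.\<close>
    let ?I1 = "\<lambda>\<omega>. (G (?p \<omega>) \<bullet> (?J \<omega>, 0)) * Y1 \<omega>
        + (G (?p \<omega>) \<bullet> (?J (?J \<omega>), 0) + H (?p \<omega>) (r *\<^sub>R ?J \<omega>, 0) \<bullet> (?J \<omega>, 0)) * Y \<omega>"
    let ?I2 = "\<lambda>\<omega>. u (?p \<omega>) * E \<omega> (?J \<omega>) + (G (?p \<omega>) \<bullet> (r *\<^sub>R ?J \<omega>, 0)) * Y1 \<omega>"
    have cp: "continuous_on S (\<lambda>\<omega>. u (?p \<omega>))" "continuous_on S (\<lambda>\<omega>. G (?p \<omega>))" for S
      using t by (intro continuous_on_u_compose continuous_on_G_compose continuous_intros; simp)+
    have "sphere_mean (\<lambda>\<omega>. (G (?p \<omega>) \<bullet> (?J \<omega>, 0)) * D \<omega> (?J \<omega>)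
        + (G (?p \<omega>) \<bullet> (?J (?J \<omega>), 0) + H (?p \<omega>) (r *\<^sub>R ?J \<omega>, 0) \<bullet> (?J \<omega>, 0)) * Y \<omega>) = 0"
    proof (rule sphere_mean_rotgen[where g = "\<lambda>\<omega>. (G (?p \<omega>) \<bullet> (?J \<omega>, 0)) * Y \<omega>"
        and Dg = "\<lambda>\<omega> v. (G (?p \<omega>) \<bullet> (?J \<omega>, 0)) * D \<omega> v
        + (G (?p \<omega>) \<bullet> (?J v, 0) + H (?p \<omega>) (r *\<^sub>R v, 0) \<bullet> (?J \<omega>, 0)) * Y \<omega>"])
      show "((\<lambda>\<omega>. (G (?p \<omega>) \<bullet> (?J \<omega>, 0)) * Y \<omega>) has_derivative (\<lambda>v. (G (?p \<omega>) \<bullet> (?J \<omega>, 0)) * D \<omega> v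
        + (G (?p \<omega>) \<bullet> (?J v, 0) + H (?p \<omega>) (r *\<^sub>R v, 0) \<bullet> (?J \<omega>, 0)) * Y \<omega>)) (at \<omega>)" for \<omega>
        by (rule has_derivative_mult[OF has_derivative_inner[OF has_derivative_compose[OF dp dG[OF t]] dJ] D(1)])
      show "continuous_on (sphere 0 1) (\<lambda>\<omega>. (G (?p \<omega>) \<bullet> (?J \<omega>, 0)) * D \<omega> v
        + (G (?p \<omega>) \<bullet> (?J v, 0) + H (?p \<omega>) (r *\<^sub>R v, 0) \<bullet> (?J \<omega>, 0)) * Y \<omega>)" for v
        using t by (intro continuous_intros cp continuous_on_H_compose cY cD cJ) auto
    qed
    then have m1: "sphere_mean ?I1 = 0" by (simp add: Y1_def)
    have m2: "sphere_mean ?I2 = 0"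
    proof (rule sphere_mean_rotgen[where g = "\<lambda>\<omega>. u (?p \<omega>) * Y1 \<omega>"
        and Dg = "\<lambda>\<omega> v. u (?p \<omega>) * E \<omega> v + (G (?p \<omega>) \<bullet> (r *\<^sub>R v, 0)) * Y1 \<omega>"])
      show "((\<lambda>\<omega>. u (?p \<omega>) * Y1 \<omega>) has_derivative
          (\<lambda>v. u (?p \<omega>) * E \<omega> v + (G (?p \<omega>) \<bullet> (r *\<^sub>R v, 0)) * Y1 \<omega>)) (at \<omega>)" for \<omega>
        by (rule has_derivative_mult[OF has_derivative_compose[OF dp du_interior[OF t]] E(1)])
      show "continuous_on (sphere 0 1) (\<lambda>\<omega>. u (?p \<omega>) * E \<omega> v + (G (?p \<omega>) \<bullet> (r *\<^sub>R v, 0)) * Y1 \<omega>)" for v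
        by (intro continuous_intros cp cY cD)
    qed
    have "H (?p \<omega>) (r *\<^sub>R ?J \<omega>, 0) = r *\<^sub>R H (?p \<omega>) (?J \<omega>, 0)" for \<omega>
      using linear_scale[OF linear_H[OF t], of "r *\<^sub>R \<omega>" r "(?J \<omega>, 0)"] by simp
    moreover have "G (?p \<omega>) \<bullet> (r *\<^sub>R ?J \<omega>, 0) = r * (G (?p \<omega>) \<bullet> (?J \<omega>, 0))" for \<omega>
      by (simp add: inner_prod_def)
    ultimately have "(\<lambda>\<omega>. (r\<^sup>2 * (H (?p \<omega>) (?J \<omega>, 0) \<bullet> (?J \<omega>, 0))
      + r * (G (?p \<omega>) \<bullet> (?J (?J \<omega>), 0))) * Y \<omega>) =
      (\<lambda>\<omega>. (r * ?I1 \<omega> + (-1) * ?I2 \<omega>) + u (?p \<omega>) * E \<omega> (?J \<omega>))"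
      by (simp add: fun_eq_iff algebra_simps power2_eq_square)
    moreover have c1: "continuous_on (sphere 0 1) ?I1" and c2: "continuous_on (sphere 0 1) ?I2"
      using t by (intro continuous_intros cp continuous_on_H_compose cY cD cJ cJJ; simp)+
    have "sphere_mean (\<lambda>\<omega>. (r * ?I1 \<omega> + (-1) * ?I2 \<omega>) + u (?p \<omega>) * E \<omega> (?J \<omega>))
      = (r * sphere_mean ?I1 + (-1) * sphere_mean ?I2) + sphere_mean (\<lambda>\<omega>. u (?p \<omega>) * E \<omega> (?J \<omega>))"
      by (simp only: sphere_mean_add continuous_on_add continuous_on_mult continuous_on_const c1 c2 cp cY sphere_mean_cmult)
    ultimately show ?thesis unfolding m1 m2 by (simp add: mu_def)
  qed
  with Z show ?thesis by blast
qed

text \<open>The wave equation turns u_tt into the trace of the spatial Hessian. The trace without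
  its radial part is the spherical Laplacian over r^2 plus (n - 1) / r times the radial derivative;
  multiplied by 2 r^2, this is the stated system.\<close>

lemma mf_rotgen_squares:
  assumes Y: "hom_poly k Y"
  shows "\<exists>Z. (\<forall>i j. hom_poly k (Z i j)) \<and> (\<forall>r t. t > 0 \<longrightarrow>
    2 * r\<^sup>2 * mf Y (r, t) = (\<Sum>i\<in>(UNIV :: 'n set). \<Sum>j\<in>(UNIV :: 'n set). mu (Z i j) (r, t)) + 2 * r * (real CARD('n) - 1) * mr Y (r, t))"
proof -
  have "\<forall>i j. \<exists>Z. hom_poly k Z \<and> (\<forall>r t. t > 0 \<longrightarrow>
    sphere_mean (\<lambda>\<omega>. (r\<^sup>2 * (H (r *\<^sub>R \<omega>, t) (rotgen i j \<omega>, 0) \<bullet> (rotgen i j \<omega>, 0))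
      + r * (G (r *\<^sub>R \<omega>, t) \<bullet> (rotgen i j (rotgen i j \<omega>), 0))) * Y \<omega>) = mu Z (r, t))"
    by (intro allI mean_rotgen_squares[OF Y])
  then obtain Z where Z: "\<And>i j. hom_poly k (Z i j)" and eq: "\<And>i j r t. t > 0 \<Longrightarrow>
    sphere_mean (\<lambda>\<omega>. (r\<^sup>2 * (H (r *\<^sub>R \<omega>, t) (rotgen i j \<omega>, 0) \<bullet> (rotgen i j \<omega>, 0))
      + r * (G (r *\<^sub>R \<omega>, t) \<bullet> (rotgen i j (rotgen i j \<omega>), 0))) * Y \<omega>) = mu (Z i j) (r, t)"
    unfolding choice_iff by blast
  have main: "2 * r\<^sup>2 * mf Y (r, t) = (\<Sum>i\<in>UNIV. \<Sum>j\<in>UNIV. mu (Z i j) (r, t)) + 2 * r * (real CARD('n) - 1) * mr Y (r, t)"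
    if t: "t > 0" for r t
  proof -
    let ?p = "\<lambda>\<omega> :: real^'n. (r *\<^sub>R \<omega>, t)"
    let ?T = "\<lambda>i j \<omega>. (r\<^sup>2 * (H (?p \<omega>) (rotgen i j \<omega>, 0) \<bullet> (rotgen i j \<omega>, 0))
      + r * (G (?p \<omega>) \<bullet> (rotgen i j (rotgen i j \<omega>), 0))) * Y \<omega>"
    have cY: "continuous_on S Y" for S by (rule continuous_on_hom_poly[OF Y])
    have cp: "continuous_on S (\<lambda>\<omega>. G (?p \<omega>))" for S
      using t by (intro continuous_on_G_compose continuous_intros; simp)
    have cJ: "continuous_on S (rotgen i j)" for S and i j :: 'n
      by (rule linear_continuous_on) (simp add: linear_rotgen flip: linear_conv_bounded_linear)
    have cJJ: "continuous_on S (\<lambda>x. rotgen i j (rotgen i j x))" for S and i j :: 'n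
      by (rule continuous_on_compose2[OF cJ[of UNIV] cJ]) auto
    have cT: "continuous_on (sphere 0 1) (?T i j)" for i j
      using t by (intro continuous_intros cp continuous_on_H_compose cY cJ cJJ) auto
    have "(\<Sum>i\<in>UNIV. \<Sum>j\<in>UNIV. mu (Z i j) (r, t)) = (\<Sum>i\<in>UNIV. \<Sum>j\<in>UNIV. sphere_mean (?T i j))"
      by (simp only: eq[OF t])
    also have "\<dots> = sphere_mean (\<lambda>\<omega>. \<Sum>i\<in>UNIV. \<Sum>j\<in>UNIV. ?T i j \<omega>)"
    proof -
      have "sphere_mean (\<lambda>\<omega>. \<Sum>i\<in>UNIV. \<Sum>j\<in>UNIV. ?T i j \<omega>) = (\<Sum>i\<in>UNIV. sphere_mean (\<lambda>\<omega>. \<Sum>j\<in>UNIV. ?T i j \<omega>))"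
        by (rule sphere_mean_sum[OF finite continuous_on_sum[OF cT]])
      also have "\<dots> = (\<Sum>i\<in>UNIV. \<Sum>j\<in>UNIV. sphere_mean (?T i j))"
        by (rule sum.cong[OF refl sphere_mean_sum[OF finite cT]])
      finally show ?thesis by (rule sym)
    qed
    also have "\<dots> = sphere_mean (\<lambda>\<omega>. (2 * r\<^sup>2) * ((H (?p \<omega>) (0, 1) \<bullet> (0, 1) - H (?p \<omega>) (\<omega>, 0) \<bullet> (\<omega>, 0)) * Y \<omega>)
        + (- 2 * r * (real CARD('n) - 1)) * ((G (?p \<omega>) \<bullet> (\<omega>, 0)) * Y \<omega>))"
    proof (rule sphere_mean_cong)
      fix \<omega> :: "real^'n" assume \<omega>: "norm \<omega> = 1"
      interpret linear "H (?p \<omega>)" by (rule linear_H[OF t])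
      have pair: "(x + y, 0::real) = (x, 0) + (y, 0)" "(c *\<^sub>R x, 0::real) = c *\<^sub>R (x, 0)" for x y :: "real^'n" and c
        by simp_all
      have "bilinear (\<lambda>x y. H (?p \<omega>) (x, 0) \<bullet> (y, 0))"
        unfolding bilinear_def
        by (intro conjI allI linearI) (simp_all only: pair add scaleR inner_add_left inner_add_right
            inner_scaleR_left inner_scaleR_right real_scaleR_def)
      moreover have "linear (\<lambda>x. G (?p \<omega>) \<bullet> (x, 0))"
        by (intro linearI) (simp_all only: pair inner_add_right inner_scaleR_right real_scaleR_def)
      ultimately have "(\<Sum>i\<in>UNIV. \<Sum>j\<in>UNIV. r\<^sup>2 * (H (?p \<omega>) (rotgen i j \<omega>, 0) \<bullet> (rotgen i j \<omega>, 0))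
          + r * (G (?p \<omega>) \<bullet> (rotgen i j (rotgen i j \<omega>), 0))) =
          2 * r\<^sup>2 * (H (?p \<omega>) (0, 1) \<bullet> (0, 1) - H (?p \<omega>) (\<omega>, 0) \<bullet> (\<omega>, 0))
          - 2 * r * (real CARD('n) - 1) * (G (?p \<omega>) \<bullet> (\<omega>, 0))"
        unfolding wave[OF t] by (rule sum_rotgen_squares[OF _ _ \<omega>])
      then show "(\<Sum>i\<in>UNIV. \<Sum>j\<in>UNIV. ?T i j \<omega>) =
          (2 * r\<^sup>2) * ((H (?p \<omega>) (0, 1) \<bullet> (0, 1) - H (?p \<omega>) (\<omega>, 0) \<bullet> (\<omega>, 0)) * Y \<omega>)
          + (- 2 * r * (real CARD('n) - 1)) * ((G (?p \<omega>) \<bullet> (\<omega>, 0)) * Y \<omega>)"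
        by (simp only: sum_distrib_right[symmetric]) (simp add: algebra_simps)
    qed
    also have "\<dots> = (2 * r\<^sup>2) * mf Y (r, t) + (- 2 * r * (real CARD('n) - 1)) * mr Y (r, t)"
    proof -
      have c: "continuous_on (sphere 0 1) (\<lambda>\<omega>. (H (?p \<omega>) (0, 1) \<bullet> (0, 1) - H (?p \<omega>) (\<omega>, 0) \<bullet> (\<omega>, 0)) * Y \<omega>)"
        using t by (intro continuous_intros continuous_on_H_compose cY) auto
      have c': "continuous_on (sphere 0 1) (\<lambda>\<omega>. (G (?p \<omega>) \<bullet> (\<omega>, 0)) * Y \<omega>)"
        by (intro continuous_intros cp cY)
      show ?thesis
        using sphere_mean_add[OF continuous_on_mult_left[OF c, of "2 * r\<^sup>2"]
            continuous_on_mult_left[OF c', of "- 2 * r * (real CARD('n) - 1)"]]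
        by (simp only: sphere_mean_cmult mf_def mr_def fst_conv snd_conv)
    qed
    finally show ?thesis by linarith
  qed
  show ?thesis by (intro exI[of _ Z] conjI allI impI Z main)
qed

text \<open>The moment is linear in the polynomial, so \<open>C\<close> can be the sum of the
  absolute coefficients in any expansion of \<open>Z\<close> into monomials.\<close>

lemma mu_hom_poly_bound:
  assumes "hom_poly k Z"
  shows "\<exists>C\<ge>0. \<forall>r t. t \<ge> 0 \<longrightarrow> \<bar>mu Z (r, t)\<bar> \<le> C * (\<Sum>l | length l = k. \<bar>mu (cmono l) (r, t)\<bar>)"
proof -
  obtain c where Z: "Z = (\<lambda>x. \<Sum>l | length l = k. c l * cmono l x)" using hom_poly_expansion[OF assms] by blast
  let ?L = "{l :: 'n list. length l = k}"
  note fin = finite_lists_of_length[of k, where 'n = 'n]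
  have "\<bar>mu Z (r, t)\<bar> \<le> (\<Sum>l\<in>?L. \<bar>c l\<bar>) * (\<Sum>l\<in>?L. \<bar>mu (cmono l) (r, t)\<bar>)" if "t \<ge> 0" for r t
  proof -
    have cu': "continuous_on (sphere 0 1) (\<lambda>\<omega>. u (r *\<^sub>R \<omega>, t))"
      using that by (intro continuous_on_u_compose continuous_intros) auto
    have "mu Z (r, t) = sphere_mean (\<lambda>\<omega>. \<Sum>l\<in>?L. c l * (u (r *\<^sub>R \<omega>, t) * cmono l \<omega>))"
      by (simp add: mu_def Z sum_distrib_left mult.left_commute)
    also have "\<dots> = (\<Sum>l\<in>?L. sphere_mean (\<lambda>\<omega>. c l * (u (r *\<^sub>R \<omega>, t) * cmono l \<omega>)))"
      by (intro sphere_mean_sum fin continuous_intros cu' continuous_on_cmono)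
    also have "\<dots> = (\<Sum>l\<in>?L. c l * mu (cmono l) (r, t))" by (simp add: sphere_mean_cmult mu_def)
    also have "\<bar>\<dots>\<bar> \<le> (\<Sum>l\<in>?L. \<bar>c l\<bar> * \<bar>mu (cmono l) (r, t)\<bar>)"
      using sum_abs[of "\<lambda>l. c l * mu (cmono l) (r, t)" ?L] by (simp add: abs_mult)
    also have "\<dots> \<le> (\<Sum>l\<in>?L. (\<Sum>l\<in>?L. \<bar>c l\<bar>) * \<bar>mu (cmono l) (r, t)\<bar>)"
      by (intro sum_mono mult_right_mono member_le_sum fin) auto
    finally show ?thesis by (simp add: sum_distrib_left)
  qed
  then show ?thesis by (intro exI[of _ "\<Sum>l\<in>?L. \<bar>c l\<bar>"]) (auto intro: sum_nonneg)
qed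

text \<open>Supplies the hypothesis on \<open>F\<close> of the triangle lemma. Away from r = 0 the
  coefficients 1 / r^2 and (n - 1) / r are bounded, and \<open>K\<close> depends only on the degree,
  the distance \<delta> and the dimension.\<close>

lemma mf_bound:
  assumes \<delta>: "\<delta> > 0"
  shows "\<exists>K. \<forall>l r t. length l = k \<longrightarrow> r \<ge> \<delta> \<longrightarrow> t > 0 \<longrightarrow> \<bar>mf (cmono l) (r, t)\<bar> \<le>
    K * (\<Sum>m | length m = k. \<bar>mu (cmono m) (r, t)\<bar> + \<bar>mr (cmono m) (r, t)\<bar> + \<bar>mt (cmono m) (r, t)\<bar>)"
proof -
  let ?L = "{l :: 'n list. length l = k}"
  let ?S = "\<lambda>r t. \<Sum>m\<in>?L. \<bar>mu (cmono m) (r, t)\<bar> + \<bar>mr (cmono m) (r, t)\<bar> + \<bar>mt (cmono m) (r, t)\<bar>"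
  note fin = finite_lists_of_length[of k, where 'n = 'n]
  have S0: "?S r t \<ge> 0" for r t by (intro sum_nonneg) auto
  have "\<exists>K\<ge>0. \<forall>r t. r \<ge> \<delta> \<longrightarrow> t > 0 \<longrightarrow> \<bar>mf (cmono l) (r, t)\<bar> \<le> K * ?S r t" if l: "l \<in> ?L" for l
  proof -
    obtain Z where Z: "\<And>i j. hom_poly k (Z i j)" and eq: "\<And>r t. t > 0 \<Longrightarrow>
      2 * r\<^sup>2 * mf (cmono l) (r, t) = (\<Sum>i\<in>(UNIV :: 'n set). \<Sum>j\<in>(UNIV :: 'n set). mu (Z i j) (r, t)) + 2 * r * (real CARD('n) - 1) * mr (cmono l) (r, t)"
      using mf_rotgen_squares[OF hom_poly.cmono, of l k] l by blast
    have "\<forall>i j. \<exists>C\<ge>0. \<forall>r t. t \<ge> 0 \<longrightarrow> \<bar>mu (Z i j) (r, t)\<bar> \<le> C * (\<Sum>l | length l = k. \<bar>mu (cmono l) (r, t)\<bar>)"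
      by (intro allI mu_hom_poly_bound Z)
    then obtain C where C: "\<And>i j. C i j \<ge> 0" "\<And>i j r t. t \<ge> 0 \<Longrightarrow>
        \<bar>mu (Z i j) (r, t)\<bar> \<le> C i j * (\<Sum>l | length l = k. \<bar>mu (cmono l) (r, t)\<bar>)"
      unfolding choice_iff by blast
    \<comment> \<open>The first summand bounds the angular moments after division by 2 r^2, the
      second bounds the coefficient (n - 1) / r of \<open>mr\<close>.\<close>
    define K where "K = (\<Sum>i\<in>UNIV. \<Sum>j\<in>UNIV. C i j) / (2 * \<delta>\<^sup>2) + real CARD('n) / \<delta>"
    have CC: "0 \<le> (\<Sum>i\<in>UNIV. \<Sum>j\<in>UNIV. C i j)" using C by (intro sum_nonneg) auto
    have "\<bar>mf (cmono l) (r, t)\<bar> \<le> K * ?S r t" if r: "r \<ge> \<delta>" and t: "t > 0" for r t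
    proof -
      have r0: "r > 0" using r \<delta> by simp
      have n1: "real CARD('n) \<ge> 1" by (simp add: Suc_leI)
      let ?M = "\<Sum>i\<in>UNIV. \<Sum>j\<in>UNIV. mu (Z i j) (r, t)"
      have "(\<Sum>l\<in>?L. \<bar>mu (cmono l) (r, t)\<bar>) \<le> ?S r t" by (intro sum_mono) auto
      then have "\<bar>mu (Z i j) (r, t)\<bar> \<le> C i j * ?S r t" for i j
        by (rule order_trans[OF C(2)[OF less_imp_le[OF t]] mult_left_mono[OF _ C(1)]])
      then have "\<bar>?M\<bar> \<le> (\<Sum>i\<in>UNIV. \<Sum>j\<in>UNIV. C i j * ?S r t)"
        by (intro order_trans[OF sum_abs] sum_mono)
      then have M: "\<bar>?M\<bar> \<le> (\<Sum>i\<in>UNIV. \<Sum>j\<in>UNIV. C i j) * ?S r t"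
        by (simp add: sum_distrib_right)
      have "\<bar>mr (cmono l) (r, t)\<bar> \<le> \<bar>mu (cmono l) (r, t)\<bar> + \<bar>mr (cmono l) (r, t)\<bar> + \<bar>mt (cmono l) (r, t)\<bar>"
        by simp
      also have "\<dots> \<le> ?S r t" by (rule member_le_sum[OF l _ fin]) auto
      finally have R: "\<bar>mr (cmono l) (r, t)\<bar> \<le> ?S r t" .
      have "mf (cmono l) (r, t) = (2 * r\<^sup>2 * mf (cmono l) (r, t)) / (2 * r\<^sup>2)" using r0 by simp
      also have "\<dots> = ?M / (2 * r\<^sup>2) + (real CARD('n) - 1) / r * mr (cmono l) (r, t)"
        unfolding eq[OF t] using r0 by (simp add: add_divide_distrib power2_eq_square)
      also have "\<bar>\<dots>\<bar> \<le> \<bar>?M / (2 * r\<^sup>2)\<bar> + \<bar>(real CARD('n) - 1) / r * mr (cmono l) (r, t)\<bar>"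
        by (rule abs_triangle_ineq)
      also have "\<dots> = \<bar>?M\<bar> / (2 * r\<^sup>2) + (real CARD('n) - 1) / r * \<bar>mr (cmono l) (r, t)\<bar>"
        using r0 n1 by (simp add: abs_mult)
      also have "\<dots> \<le> ((\<Sum>i\<in>UNIV. \<Sum>j\<in>UNIV. C i j) * ?S r t) / (2 * \<delta>\<^sup>2) + real CARD('n) / \<delta> * ?S r t"
      proof (rule add_mono)
        show "\<bar>?M\<bar> / (2 * r\<^sup>2) \<le> ((\<Sum>i\<in>UNIV. \<Sum>j\<in>UNIV. C i j) * ?S r t) / (2 * \<delta>\<^sup>2)"
        proof (rule frac_le[OF mult_nonneg_nonneg[OF CC S0] M])
          show "2 * \<delta>\<^sup>2 \<le> 2 * r\<^sup>2" using r \<delta> power_mono[of \<delta> r 2] by linarith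
          show "0 < 2 * \<delta>\<^sup>2" using \<delta> by simp
        qed
        have "(real CARD('n) - 1) / r \<le> real CARD('n) / \<delta>"
          using n1 \<delta> r by (intro frac_le) linarith+
        then show "(real CARD('n) - 1) / r * \<bar>mr (cmono l) (r, t)\<bar> \<le> real CARD('n) / \<delta> * ?S r t"
          using \<delta> by (intro mult_mono R) simp_all
      qed
      also have "\<dots> = K * ?S r t" by (simp add: K_def algebra_simps)
      finally show ?thesis .
    qed
    moreover have "K \<ge> 0" unfolding K_def using CC \<delta> by simp
    ultimately show ?thesis by blast
  qed
  then have "\<forall>l\<in>?L. \<exists>K. K \<ge> 0 \<and> (\<forall>r t. r \<ge> \<delta> \<longrightarrow> t > 0 \<longrightarrow> \<bar>mf (cmono l) (r, t)\<bar> \<le> K * ?S r t)"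
    by blast
  from bchoice[OF this] obtain K where K: "\<forall>l\<in>?L. K l \<ge> 0 \<and> (\<forall>r t. r \<ge> \<delta> \<longrightarrow> t > 0 \<longrightarrow> \<bar>mf (cmono l) (r, t)\<bar> \<le> K l * ?S r t)" ..
  have "\<bar>mf (cmono l) (r, t)\<bar> \<le> (\<Sum>l\<in>?L. K l) * ?S r t" if "l \<in> ?L" "r \<ge> \<delta>" "t > 0" for l r t
  proof -
    have "K l \<le> (\<Sum>l\<in>?L. K l)" by (rule member_le_sum[OF that(1) _ fin]) (use K in auto)
    then have "K l * ?S r t \<le> (\<Sum>l\<in>?L. K l) * ?S r t" by (rule mult_right_mono[OF _ S0])
    moreover have "\<bar>mf (cmono l) (r, t)\<bar> \<le> K l * ?S r t" using bspec[OF K that(1)] that by simp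
    ultimately show ?thesis by (rule order_trans[rotated])
  qed
  then show ?thesis by (intro exI[of _ "\<Sum>l\<in>?L. K l"]) auto
qed

section \<open>Vanishing of the moments outside and inside the ball\<close>

lemma continuous_on_moment_compose:
  assumes "continuous_on S r" "continuous_on S t" "\<And>z. z \<in> S \<Longrightarrow> t z \<ge> 0"
  shows "continuous_on S (\<lambda>z. mu (cmono l) (r z, t z))" "continuous_on S (\<lambda>z. mr (cmono l) (r z, t z))"
    "continuous_on S (\<lambda>z. mt (cmono l) (r z, t z))"
  using assms
  by (auto intro!: continuous_on_compose2[OF continuous_on_moments(1)[OF continuous_on_cmono]]
      continuous_on_compose2[OF continuous_on_moments(2)[OF continuous_on_cmono]]
      continuous_on_compose2[OF continuous_on_moments(3)[OF continuous_on_cmono]] continuous_intros)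

text \<open>A one-sided derivative along a segment with s \<ge> 0, which stays in the closed
  half-space; thus it also applies at t = 0.\<close>

lemma gradient_zero:
  assumes "t \<ge> 0" "d > 0" "\<And>h. 0 \<le> h \<Longrightarrow> h < d \<Longrightarrow> u (x + h *\<^sub>R y, t + h * s) = 0" "s \<ge> 0"
  shows "G (x, t) \<bullet> (y, s) = 0"
proof -
  let ?g = "\<lambda>h. (x + h *\<^sub>R y, t + h * s)"
  have 1: "(?g has_derivative (\<lambda>h. h *\<^sub>R (y, s))) (at 0 within {0..<d})"
    by (auto intro!: derivative_eq_intros)
  have "?g ` {0..<d} \<subseteq> closed_half" using assms by auto
  then have "(u has_derivative (\<lambda>h. G (x, t) \<bullet> h)) (at (?g 0) within ?g ` {0..<d})"
    using has_derivative_subset[OF du[OF assms(1)]] by simp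
  from has_derivative_in_compose[OF 1 this]
  have "((\<lambda>h. u (?g h)) has_derivative (\<lambda>h. G (x, t) \<bullet> (h *\<^sub>R (y, s)))) (at 0 within {0..<d})" .
  then have 2: "((\<lambda>h. u (?g h)) has_vector_derivative G (x, t) \<bullet> (y, s)) (at 0 within {0..<d})"
    by (simp only: has_vector_derivative_def inner_scaleR_right real_scaleR_def)
  have "((\<lambda>h. u (?g h)) has_vector_derivative 0) (at 0 within {0..<d})"
    by (rule has_vector_derivative_transform[OF _ _ has_vector_derivative_const])
      (use assms in auto)
  moreover have "at (0::real) within {0..<d} \<noteq> bot"
    using \<open>d > 0\<close> by (simp add: trivial_limit_within islimpt_greaterThanLessThan1 islimpt_Ico)
  ultimately show ?thesis using 2 vector_derivative_unique_within by blast
qed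

text \<open>The gain is \<open>mr\<close>: the observation gives \<open>u\<close> on the sphere but
  not its normal derivative. Here t is the time variable and r - 1 the space variable of the
  triangle lemma.\<close>

lemma exterior_moments_zero:
  assumes obs: "\<And>\<omega> t. norm \<omega> = 1 \<Longrightarrow> 0 < t \<Longrightarrow> t < 1 \<Longrightarrow> u (\<omega>, t) = 0"
    and ext: "\<And>x. norm x \<ge> 1 \<Longrightarrow> u (x, 0) = 0 \<and> G (x, 0) = 0"
    and t: "0 \<le> t" "t < 1"
  shows "mu (cmono l) (1, t) = 0 \<and> mr (cmono l) (1, t) = 0 \<and> mt (cmono l) (1, t) = 0"
proof -
  define k where "k = length l"
  \<comment> \<open>The triangle with corner (t, 0) touches the sphere only up to time t < 1, hence
    within the observation.\<close>
  define c where "c = t"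
  have c: "c < 1" "c \<ge> 0" using t by (auto simp: c_def)
  let ?A = "{l :: 'n list. length l = k}"
  let ?U = "\<lambda>l z. mu (cmono l) (1 + snd z, fst z)"
  let ?Us = "\<lambda>l z. mt (cmono l) (1 + snd z, fst z)"
  let ?Uy = "\<lambda>l z. mr (cmono l) (1 + snd z, fst z)"
  let ?F = "\<lambda>l z. mf (cmono l) (1 + snd z, fst z)"
  let ?T = "{(s, y). 0 \<le> s \<and> 0 \<le> y \<and> s + y \<le> c}"
  obtain K where K: "\<And>l r t. length l = k \<Longrightarrow> r \<ge> 1 \<Longrightarrow> t > 0 \<Longrightarrow> \<bar>mf (cmono l) (r, t)\<bar> \<le>
    K * (\<Sum>m\<in>?A. \<bar>mu (cmono m) (r, t)\<bar> + \<bar>mr (cmono m) (r, t)\<bar> + \<bar>mt (cmono m) (r, t)\<bar>)"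
    using mf_bound[of 1 k] by auto
  have cont: "continuous_on ?T (?U l)" "continuous_on ?T (?Us l)" "continuous_on ?T (?Uy l)" for l
    by (intro continuous_on_moment_compose continuous_intros; auto)+
  \<comment> \<open>The Dirichlet case: \<open>u\<close> vanishes on the sphere during an interval
    of times, so its time derivative does too.\<close>
  have bd: "\<bar>?Us l (s, 0) + ?Uy l (s, 0)\<bar> = \<bar>?Us l (s, 0) - ?Uy l (s, 0)\<bar>" if "0 < s" "s \<le> c" for l s
  proof -
    have "G (\<omega>, s) \<bullet> (0, 1) = 0" if "norm \<omega> = 1" for \<omega>
      by (rule gradient_zero[of _ "1 - s"]) (use that c \<open>0 < s\<close> \<open>s \<le> c\<close> in \<open>auto intro!: obs\<close>)
    then have "mt (cmono l) (1, s) = sphere_mean (\<lambda>\<omega> :: real^'n. 0)"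
      unfolding mt_def by (intro sphere_mean_cong) simp
    then show ?thesis by (simp add: sphere_mean_def)
  qed
  have init: "?U l (0, y) = 0 \<and> ?Us l (0, y) = 0 \<and> ?Uy l (0, y) = 0" if "0 \<le> y" for l y
  proof -
    have "u ((1 + y) *\<^sub>R \<omega>, 0) = 0 \<and> G ((1 + y) *\<^sub>R \<omega>, 0) = 0" if "norm \<omega> = 1" for \<omega>
      using ext[of "(1 + y) *\<^sub>R \<omega>"] that \<open>0 \<le> y\<close> by simp
    then have "?U l (0, y) = sphere_mean (\<lambda>\<omega> :: real^'n. 0)" "?Us l (0, y) = sphere_mean (\<lambda>\<omega> :: real^'n. 0)"
      "?Uy l (0, y) = sphere_mean (\<lambda>\<omega> :: real^'n. 0)"
      unfolding mu_def mt_def mr_def by (intro sphere_mean_cong; simp)+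
    then show ?thesis by (simp add: sphere_mean_def)
  qed
  have Fb: "\<bar>?F l (s, y)\<bar> \<le> K * (\<Sum>j\<in>?A. \<bar>?U j (s, y)\<bar> + \<bar>?Us j (s, y)\<bar> + \<bar>?Uy j (s, y)\<bar>)"
    if "l \<in> ?A" "0 < s" "0 < y" for l s y
    using K[of l "1 + y" s] that by (simp add: add_ac)
  have dU: "((\<lambda>h. ?U l (s + h, y - h)) has_real_derivative ?Us l (s, y) - ?Uy l (s, y)) (at 0)"
    if "0 < s" for l s y
    using has_real_derivative_mu[OF continuous_on_cmono that, of l "1 + y" "-1" 1] by (simp add: algebra_simps)
  have dP: "((\<lambda>h. ?Us l (s + h, y - h) + ?Uy l (s + h, y - h)) has_real_derivative ?F l (s, y)) (at 0)"
    if "0 < s" for l s y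
    using has_real_derivative_characteristic[OF continuous_on_cmono that, of 1 l "1 + y" 1] by (simp add: algebra_simps)
  have dQ: "((\<lambda>h. ?Us l (s + h, y + h) - ?Uy l (s + h, y + h)) has_real_derivative ?F l (s, y)) (at 0)"
    if "0 < s" for l s y
    using has_real_derivative_characteristic[OF continuous_on_cmono that, of "-1" l "1 + y" 1] by (simp add: algebra_simps)
  note zero = characteristic_triangle_zero[where A = ?A and c = c and U = ?U and Us = ?Us and Uy = ?Uy and F = ?F
      and K = K and s = t and y = 0 and i = l, OF finite_lists_of_length cont init bd dU dP dQ Fb]
  from zero show ?thesis using t by (simp add: c_def k_def)
qed

text \<open>The roles of r and t are exchanged: the sphere carries the Cauchy data, and the initial
  time t = 0 becomes the reflecting side.\<close>

lemma interior_moments_zero: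
  assumes side: "\<And>t. 0 \<le> t \<Longrightarrow> t < 1 \<Longrightarrow> (\<forall>l. mu (cmono l) (1, t) = 0 \<and> mr (cmono l) (1, t) = 0 \<and> mt (cmono l) (1, t) = 0)"
    and init: "(\<forall>x y. G (x, 0) \<bullet> (y, 0) = 0) \<or> (\<forall>x. G (x, 0) \<bullet> (0, 1) = 0)"
    and r: "0 < r" "r \<le> 1"
  shows "mu (cmono l) (r, 0) = 0 \<and> mt (cmono l) (r, 0) = 0"
proof -
  define k where "k = length l"
  \<comment> \<open>This triangle has (r, 0) as its corner. It uses the sphere for times up to 1 - r
    < 1 and contains no radius below r, so the bound on the source holds with \<delta> = r.\<close>
  define c where "c = 1 - r"
  have c: "c < 1" "c \<ge> 0" using r by (auto simp: c_def)
  let ?A = "{l :: 'n list. length l = k}"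
  \<comment> \<open>Time is 1 - r, so U_s = - U_r, and U_ss - U_yy = U_rr - U_tt explains the sign
    of \<open>?F\<close>.\<close>
  let ?U = "\<lambda>l z. mu (cmono l) (1 - fst z, snd z)"
  let ?Us = "\<lambda>l z. - mr (cmono l) (1 - fst z, snd z)"
  let ?Uy = "\<lambda>l z. mt (cmono l) (1 - fst z, snd z)"
  let ?F = "\<lambda>l z. - mf (cmono l) (1 - fst z, snd z)"
  let ?T = "{(s, y). 0 \<le> s \<and> 0 \<le> y \<and> s + y \<le> c}"
  obtain K where K: "\<And>l \<rho> t. length l = k \<Longrightarrow> \<rho> \<ge> r \<Longrightarrow> t > 0 \<Longrightarrow> \<bar>mf (cmono l) (\<rho>, t)\<bar> \<le>
    K * (\<Sum>m\<in>?A. \<bar>mu (cmono m) (\<rho>, t)\<bar> + \<bar>mr (cmono m) (\<rho>, t)\<bar> + \<bar>mt (cmono m) (\<rho>, t)\<bar>)"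
    using mf_bound[OF r(1), of k] by auto
  have cont: "continuous_on ?T (?U l)" "continuous_on ?T (?Us l)" "continuous_on ?T (?Uy l)" for l
    by (intro continuous_on_moment_compose continuous_on_minus continuous_intros; auto)+
  \<comment> \<open>The zero datum enters here. If a = 0 the radial derivative vanishes at t = 0, a
    Dirichlet condition; if b = 0 the time derivative does, a Neumann condition.\<close>
  have bd: "\<bar>?Us l (s, 0) + ?Uy l (s, 0)\<bar> = \<bar>?Us l (s, 0) - ?Uy l (s, 0)\<bar>" for l s
    using init
  proof
    assume *: "\<forall>x y. G (x, 0) \<bullet> (y, 0) = 0"
    have "mr (cmono l) (1 - s, 0) = 0" by (simp add: mr_def * sphere_mean_def)
    then show ?thesis by simp
  next
    assume *: "\<forall>x. G (x, 0) \<bullet> (0, 1) = 0"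
    have "mt (cmono l) (1 - s, 0) = 0" by (simp add: mt_def * sphere_mean_def)
    then show ?thesis by simp
  qed
  have init: "?U l (0, y) = 0 \<and> ?Us l (0, y) = 0 \<and> ?Uy l (0, y) = 0" if "0 \<le> y" "y \<le> c" for l y
    using side[of y] that c by simp
  have Fb: "\<bar>?F l (s, y)\<bar> \<le> K * (\<Sum>j\<in>?A. \<bar>?U j (s, y)\<bar> + \<bar>?Us j (s, y)\<bar> + \<bar>?Uy j (s, y)\<bar>)"
    if "l \<in> ?A" "0 < s" "0 < y" "s + y \<le> c" for l s y
    using K[of l "1 - s" y] that by (simp add: c_def)
  have dU: "((\<lambda>h. ?U l (s + h, y - h)) has_real_derivative ?Us l (s, y) - ?Uy l (s, y)) (at 0)"
    if "0 < y" for l s y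
    using has_real_derivative_mu[OF continuous_on_cmono that, of l "1 - s" "-1" "-1"] by (simp add: algebra_simps)
  have dP: "((\<lambda>h. ?Us l (s + h, y - h) + ?Uy l (s + h, y - h)) has_real_derivative ?F l (s, y)) (at 0)"
    if "0 < y" for l s y
    using has_real_derivative_characteristic[OF continuous_on_cmono that, of "-1" l "1 - s" "-1"] by (simp add: algebra_simps)
  have dQ: "((\<lambda>h. ?Us l (s + h, y + h) - ?Uy l (s + h, y + h)) has_real_derivative ?F l (s, y)) (at 0)"
    if "0 < y" for l s y
    using DERIV_minus[OF has_real_derivative_characteristic[OF continuous_on_cmono that, of 1 l "1 - s" 1]] by (simp add: algebra_simps)
  note zero = characteristic_triangle_zero[where A = ?A and c = c and U = ?U and Us = ?Us and Uy = ?Uy and F = ?F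
      and K = K and s = c and y = 0 and i = l, OF finite_lists_of_length cont init bd dU dP dQ Fb]
  from zero show ?thesis using r by (simp add: c_def k_def)
qed

lemma initial_data_zero:
  assumes obs: "\<And>\<omega> t. norm \<omega> = 1 \<Longrightarrow> 0 < t \<Longrightarrow> t < 1 \<Longrightarrow> u (\<omega>, t) = 0"
    and K: "closed K" "K \<subseteq> ball 0 1" "\<And>x. x \<notin> K \<Longrightarrow> u (x, 0) = 0 \<and> G (x, 0) \<bullet> (0, 1) = 0"
    and init: "(\<forall>x. u (x, 0) = 0) \<or> (\<forall>x. G (x, 0) \<bullet> (0, 1) = 0)"
  shows "u (x, 0) = 0" "G (x, 0) \<bullet> (0, 1) = 0"
proof -
  \<comment> \<open>Used twice: on the complement of \<open>K\<close>, and on the whole space when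
    the first datum vanishes.\<close>
  have tangential: "G (x, 0) \<bullet> (y, 0) = 0" if V: "open V" "x \<in> V" "\<And>z. z \<in> V \<Longrightarrow> u (z, 0) = 0" for x y V
  proof -
    obtain e where e: "e > 0" "ball x e \<subseteq> V" using V(1,2) openE by blast
    have "h * norm y < e" if "0 \<le> h" "h < e / (norm y + 1)" for h
    proof -
      have "h * norm y \<le> h * (norm y + 1)" using that by (intro mult_left_mono) auto
      also have "\<dots> < e" using that(2) norm_ge_zero[of y] by (simp add: pos_less_divide_eq add_nonneg_pos)
      finally show ?thesis .
    qed
    then have "x + h *\<^sub>R y \<in> V" if "0 \<le> h" "h < e / (norm y + 1)" for h
      using that e(2) by (intro subsetD[OF e(2)]) (simp add: dist_norm)
    note inV = this
    show ?thesis
    proof (rule gradient_zero)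
      show "0 < e / (norm y + 1)" using e(1) by (simp add: add_nonneg_pos)
      show "u (x + h *\<^sub>R y, 0 + h * 0) = 0" if "0 \<le> h" "h < e / (norm y + 1)" for h
        using V(3)[OF inV[OF that]] by simp
    qed simp_all
  qed
  \<comment> \<open>\<open>K\<close> is closed and lies in the open ball, so even points of the unit
    sphere have a neighbourhood that misses \<open>K\<close>. The spatial gradient therefore
    vanishes there together with the data.\<close>
  have ext: "u (x, 0) = 0 \<and> G (x, 0) = 0" if "norm x \<ge> 1" for x
  proof -
    have x: "x \<in> - K" using K(2) that by auto
    have "G (x, 0) \<bullet> (fst v, 0) = 0" for v :: "(real^'n) \<times> real"
      by (rule tangential[of "- K"]) (use K x in auto)
    moreover have "G (x, 0) \<bullet> v = G (x, 0) \<bullet> (fst v, 0) + snd v * (G (x, 0) \<bullet> (0, 1))" for v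
      by (simp add: inner_prod_def)
    moreover have "G (x, 0) \<bullet> (0, 1) = 0" using K(3) x by simp
    ultimately have "G (x, 0) \<bullet> v = 0" for v by (metis add_0 mult_zero_right)
    then have "G (x, 0) \<bullet> G (x, 0) = 0" by blast
    then show ?thesis using K(3) x by simp
  qed
  have "(\<forall>x y. G (x, 0) \<bullet> (y, 0) = 0) \<or> (\<forall>x. G (x, 0) \<bullet> (0, 1) = 0)"
    using init
  proof
    assume "\<forall>x. u (x, 0) = 0"
    then have "G (x, 0) \<bullet> (y, 0) = 0" for x y
      by (intro tangential[OF open_UNIV UNIV_I]) simp
    then show ?thesis by simp
  qed simp
  then have m: "mu (cmono l) (r, 0) = 0 \<and> mt (cmono l) (r, 0) = 0" if "0 < r" "r \<le> 1" for l r
    by (intro interior_moments_zero[OF _ _ that] allI exterior_moments_zero[OF obs ext])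
  have cu0: "continuous_on S (\<lambda>x. u (x, 0))" and cG0: "continuous_on S (\<lambda>x. G (x, 0) \<bullet> (0, 1))" for S
    by (intro continuous_intros continuous_on_u_compose continuous_on_G_compose; simp)+
  have sph: "u (r *\<^sub>R \<omega>, 0) = 0 \<and> G (r *\<^sub>R \<omega>, 0) \<bullet> (0, 1) = 0"
    if r: "0 < r" "r \<le> 1" and \<omega>: "norm \<omega> = 1" for r \<omega>
  proof
    show "u (r *\<^sub>R \<omega>, 0) = 0"
    proof (rule sphere_mean_cmono_complete[where g = "\<lambda>\<omega>. u (r *\<^sub>R \<omega>, 0)", OF _ _ \<omega>])
      show "sphere_mean (\<lambda>\<omega>. u (r *\<^sub>R \<omega>, 0) * cmono l \<omega>) = 0" for l
        using m[OF r, of l] by (simp add: mu_def)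
      show "continuous_on (sphere 0 1) (\<lambda>\<omega>. u (r *\<^sub>R \<omega>, 0))"
        by (intro continuous_on_u_compose continuous_intros) auto
    qed
    show "G (r *\<^sub>R \<omega>, 0) \<bullet> (0, 1) = 0"
    proof (rule sphere_mean_cmono_complete[where g = "\<lambda>\<omega>. G (r *\<^sub>R \<omega>, 0) \<bullet> (0, 1)", OF _ _ \<omega>])
      show "sphere_mean (\<lambda>\<omega>. (G (r *\<^sub>R \<omega>, 0) \<bullet> (0, 1)) * cmono l \<omega>) = 0" for l
        using m[OF r, of l] by (simp add: mt_def)
      show "continuous_on (sphere 0 1) (\<lambda>\<omega>. G (r *\<^sub>R \<omega>, 0) \<bullet> (0, 1))"
        by (intro continuous_intros continuous_on_G_compose) auto
    qed
  qed
  have nz: "u (x, 0) = 0 \<and> G (x, 0) \<bullet> (0, 1) = 0" if "x \<in> - {0}" for x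
  proof (cases "norm x \<ge> 1")
    case True
    then show ?thesis using ext by simp
  next
    case False
    then show ?thesis using sph[of "norm x" "sgn x"] that by (simp add: norm_sgn sgn_div_norm)
  qed
  \<comment> \<open>The moments determine the data only for r > 0; the origin is reached by density
    and continuity.\<close>
  have cl: "closure (- {0 :: real^'n}) = UNIV" by (simp add: closure_complement)
  show "u (x, 0) = 0"
    by (rule continuous_constant_on_closure[of "- {0}" "\<lambda>x. u (x, 0)"]) (use cu0 nz cl in auto)
  show "G (x, 0) \<bullet> (0, 1) = 0"
    by (rule continuous_constant_on_closure[of "- {0}" "\<lambda>x. G (x, 0) \<bullet> (0, 1)"]) (use cG0 nz cl in auto)
qed

end

subsection \<open>Classical solutions\<close>

lemma has_derivative_partial_on:
  fixes f :: "'a::euclidean_space \<Rightarrow> real"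
  assumes "f differentiable (at p within D)"
  shows "(f has_derivative (\<lambda>h. \<Sum>v\<in>Basis. (h \<bullet> v) * partial_on D v f p)) (at p within D)"
proof -
  have d: "(f has_derivative frechet_derivative f (at p within D)) (at p within D)"
    using assms by (simp add: frechet_derivative_works)
  interpret linear "frechet_derivative f (at p within D)" by (rule has_derivative_linear[OF d])
  have "frechet_derivative f (at p within D) h = (\<Sum>v\<in>Basis. (h \<bullet> v) * partial_on D v f p)" for h
  proof -
    have "frechet_derivative f (at p within D) h = frechet_derivative f (at p within D) (\<Sum>v\<in>Basis. (h \<bullet> v) *\<^sub>R v)"
      by (simp add: euclidean_representation)
    then show ?thesis by (simp only: sum scaleR partial_on_def real_scaleR_def)
  qed
  then have "frechet_derivative f (at p within D) = (\<lambda>h. \<Sum>v\<in>Basis. (h \<bullet> v) * partial_on D v f p)" ..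
  with d show ?thesis by simp
qed

text \<open>\<open>G\<close> is built from derivatives within the closed half-space, so that it is
  continuous up to t = 0 and contains the datum b. \<open>H\<close> is built from derivatives within
  the open half-space, where the wave equation is stated.\<close>

lemma solves_wave_cauchy_imp_wave_jet:
  fixes u :: "(real^'n::finite) \<times> real \<Rightarrow> real"
  assumes "solves_wave_cauchy u a b"
  obtains G H where "wave_jet u G H" "\<And>x. u (x, 0) = a x" "\<And>x. G (x, 0) \<bullet> (0, 1) = b x"
proof -
  let ?O = "open_half :: ((real^'n) \<times> real) set" and ?C = "closed_half :: ((real^'n) \<times> real) set"
  define Q where "Q v = partial_on ?O v u" for v
  have O: "open ?O" by (simp add: open_Times)
  have s: "Ck_on 2 ?O u" "Ck_on 1 ?C u" "\<And>x t. t > 0 \<Longrightarrow> d_tt u (x, t) - laplace_x u (x, t) = 0"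
    "\<And>x. u (x, 0) = a x" "\<And>x. partial_on ?C (0, 1) u (x, 0) = b x"
    using assms unfolding solves_wave_cauchy_def by blast+
  note C1 = s(2)[unfolded One_nat_def Ck_on.simps differentiable_on_def]
  have uC: "u differentiable (at p within ?C)" if "p \<in> ?C" for p
    by (rule bspec[OF conjunct1[OF C1] that])
  have cP: "continuous_on ?C (partial_on ?C v u)" if "v \<in> Basis" for v
    by (rule bspec[OF conjunct2[OF C1] that])
  have CQ: "Q v differentiable_on ?O \<and> (\<forall>w\<in>Basis. continuous_on ?O (partial_on ?O w (Q v)))" if "v \<in> Basis" for v
    unfolding Q_def
    by (rule bspec[OF conjunct2[OF s(1)[unfolded numeral_2_eq_2 Ck_on.simps]] that])
  have QO: "Q v differentiable (at p within ?O)" if "v \<in> Basis" "p \<in> ?O" for v p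
    by (rule bspec[OF conjunct1[OF CQ[OF that(1)], unfolded differentiable_on_def] that(2)])
  have cQ: "continuous_on ?O (partial_on ?O w (Q v))" if "v \<in> Basis" "w \<in> Basis" for v w
    by (rule bspec[OF conjunct2[OF CQ[OF that(1)]] that(2)])
  define G where "G p = (\<Sum>v\<in>Basis. partial_on ?C v u p *\<^sub>R v)" for p
  define H where "H p h = (\<Sum>v\<in>Basis. (\<Sum>w\<in>Basis. (h \<bullet> w) * partial_on ?O w (Q v) p) *\<^sub>R v)" for p h
  \<comment> \<open>Points with t > 0 are interior to both half-spaces, so the two derivatives are
    the same there and \<open>H\<close> is indeed the derivative of \<open>G\<close>.\<close>
  have QP: "Q v p = partial_on ?C v u p" if "p \<in> ?O" for v p
  proof -
    have "?O \<subseteq> ?C" by (intro Sigma_mono) auto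
    from interior_maximal[OF this O] have "p \<in> interior ?C" by (rule subsetD[OF _ that])
    then show ?thesis
      unfolding Q_def partial_on_def at_within_open[OF that O] by (simp only: at_within_interior)
  qed
  have basis: "(0, 1) \<in> (Basis :: ((real^'n) \<times> real) set)" "(axis i 1, 0) \<in> (Basis :: ((real^'n) \<times> real) set)" for i
    by (auto simp: Basis_prod_def)
  have inn: "(\<Sum>v\<in>Basis. f v *\<^sub>R v) \<bullet> w = f w" if "w \<in> Basis" for f and w :: "(real^'n) \<times> real"
    using that by (simp add: inner_sum_left_Basis)
  have HQ: "H p v \<bullet> w = partial_on ?O v (Q w) p" if "v \<in> Basis" "w \<in> Basis" for p v w
  proof -
    have "H p v \<bullet> w = (\<Sum>b\<in>Basis. (v \<bullet> b) * partial_on ?O b (Q w) p)"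
      unfolding H_def by (rule inn[OF that(2)])
    also have "\<dots> = (\<Sum>b\<in>Basis. if v = b then partial_on ?O b (Q w) p else 0)"
      by (intro sum.cong refl) (simp add: inner_Basis that(1))
    also have "\<dots> = partial_on ?O v (Q w) p" using that(1) by simp
    finally show ?thesis .
  qed
  have "wave_jet u G H"
  proof
    fix x :: "real^'n" and t :: real assume "t \<ge> 0"
    then have "(x, t) \<in> ?C" by simp
    moreover have "(\<lambda>h. G (x, t) \<bullet> h) = (\<lambda>h. \<Sum>v\<in>Basis. (h \<bullet> v) * partial_on ?C v u (x, t))"
      unfolding G_def inner_sum_left inner_scaleR_left
      by (intro ext sum.cong refl) (simp add: inner_commute)
    ultimately show "(u has_derivative (\<lambda>h. G (x, t) \<bullet> h)) (at (x, t) within ?C)"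
      using has_derivative_partial_on[OF uC] by simp
  next
    show "continuous_on ?C G"
      unfolding G_def by (intro continuous_intros cP)
  next
    fix x :: "real^'n" and t :: real assume "t > 0"
    then have p: "(x, t) \<in> ?O" by simp
    have "((\<lambda>p. \<Sum>v\<in>Basis. Q v p *\<^sub>R v) has_derivative H (x, t)) (at (x, t))"
      unfolding H_def
    proof (intro has_derivative_sum has_derivative_scaleR_left)
      fix v :: "(real^'n) \<times> real" assume "v \<in> Basis"
      from has_derivative_partial_on[OF QO[OF this p]]
      show "(Q v has_derivative (\<lambda>h. \<Sum>w\<in>Basis. (h \<bullet> w) * partial_on ?O w (Q v) (x, t))) (at (x, t))"
        unfolding at_within_open[OF p O] .
    qed
    then show "(G has_derivative H (x, t)) (at (x, t))"
    proof (rule has_derivative_transform_within_open[OF _ O p])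
      show "(\<Sum>v\<in>Basis. Q v p *\<^sub>R v) = G p" if "p \<in> ?O" for p
        unfolding G_def QP[OF that] ..
    qed
  next
    fix v
    show "continuous_on ?O (\<lambda>p. H p v)"
      unfolding H_def by (intro continuous_intros cQ)
  next
    fix x :: "real^'n" and t :: real assume "t > 0"
    then have "d_tt u (x, t) = laplace_x u (x, t)" using s(3) by simp
    then show "H (x, t) (0, 1) \<bullet> (0, 1) = (\<Sum>i\<in>UNIV. H (x, t) (axis i 1, 0) \<bullet> (axis i 1, 0))"
      unfolding HQ[OF basis(1) basis(1)] HQ[OF basis(2) basis(2)] d_tt_def laplace_x_def Q_def .
  qed
  moreover have "G (x, 0) \<bullet> (0, 1) = b x" for x
    unfolding G_def inn[OF basis(1)] by (rule s(5))
  ultimately show thesis using s(4) by (intro that)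
qed

section \<open>Uniqueness of the Cauchy data and reconstruction\<close>

lemma wave_jet_diff:
  assumes "wave_jet u1 G1 H1" "wave_jet u2 G2 H2"
  shows "wave_jet (\<lambda>p. u1 p - u2 p) (\<lambda>p. G1 p - G2 p) (\<lambda>p h. H1 p h - H2 p h)"
proof -
  interpret w1: wave_jet u1 G1 H1 by fact
  interpret w2: wave_jet u2 G2 H2 by fact
  show ?thesis
  proof
    fix x :: "real^'a" and t :: real assume t: "t \<ge> 0"
    show "((\<lambda>p. u1 p - u2 p) has_derivative (\<lambda>h. (G1 (x, t) - G2 (x, t)) \<bullet> h)) (at (x, t) within closed_half)"
      unfolding inner_diff_left by (intro has_derivative_diff w1.du w2.du t)
  qed (auto intro!: continuous_intros has_derivative_diff w1.cG w2.cG w1.cH w2.cH w1.dG w2.dG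
      simp: inner_diff_left w1.wave w2.wave sum_subtractf)
qed

text \<open>The difference of the two solutions has zero observation, and the datum they share
  becomes a zero datum. The union of the four supports is the closed set that separates the data
  from the sphere.\<close>

lemma cauchy_data_unique:
  fixes u1 u2 :: "(real^'n::finite) \<times> real \<Rightarrow> real"
  assumes s: "solves_wave_cauchy u1 a1 b1" "solves_wave_cauchy u2 a2 b2"
    and supp: "supp a1 \<subseteq> ball 0 1" "supp b1 \<subseteq> ball 0 1" "supp a2 \<subseteq> ball 0 1" "supp b2 \<subseteq> ball 0 1"
    and obs: "observation u1 = observation u2"
    and one: "a1 = a2 \<or> b1 = b2"
  shows "a1 = a2 \<and> b1 = b2"
proof -
  obtain G1 H1 where 1: "wave_jet u1 G1 H1" "\<And>x. u1 (x, 0) = a1 x" "\<And>x. G1 (x, 0) \<bullet> (0, 1) = b1 x"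
    using solves_wave_cauchy_imp_wave_jet[OF s(1)] by blast
  obtain G2 H2 where 2: "wave_jet u2 G2 H2" "\<And>x. u2 (x, 0) = a2 x" "\<And>x. G2 (x, 0) \<bullet> (0, 1) = b2 x"
    using solves_wave_cauchy_imp_wave_jet[OF s(2)] by blast
  interpret wave_jet "\<lambda>p. u1 p - u2 p" "\<lambda>p. G1 p - G2 p" "\<lambda>p h. H1 p h - H2 p h"
    by (rule wave_jet_diff[OF 1(1) 2(1)])
  define K where "K = supp a1 \<union> supp b1 \<union> supp a2 \<union> supp b2"
  have out: "f x = 0" if "x \<notin> supp f" for f :: "real^'n \<Rightarrow> real" and x
    using that closure_subset[of "{x. f x \<noteq> 0}"] by (auto simp: supp_def)
  have obs': "u1 (\<omega>, t) - u2 (\<omega>, t) = 0" if "norm \<omega> = 1" "0 < t" "t < 1" for \<omega> t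
    using fun_cong[OF obs, of "(\<omega>, t)"] that by (simp add: observation_def)
  have K: "closed K" "K \<subseteq> ball 0 1"
    using supp by (auto simp: K_def supp_def)
  have outK: "u1 (x, 0) - u2 (x, 0) = 0 \<and> (G1 (x, 0) - G2 (x, 0)) \<bullet> (0, 1) = 0" if "x \<notin> K" for x
    using that out[of x a1] out[of x b1] out[of x a2] out[of x b2] by (simp add: K_def 1 2 inner_diff_left)
  have one': "(\<forall>x. u1 (x, 0) - u2 (x, 0) = 0) \<or> (\<forall>x. (G1 (x, 0) - G2 (x, 0)) \<bullet> (0, 1) = 0)"
    using one by (auto simp: 1 2 inner_diff_left)
  show ?thesis
    using initial_data_zero[OF obs' K outK one'] by (simp add: 1 2 inner_diff_left fun_eq_iff)
qed

text \<open>Recovery amounts to the observation determining the value. The map \<open>R\<close>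
  chooses any admissible object with the given observation, and the hypothesis makes its value
  independent of that choice.\<close>

lemma reconstruction_exists:
  assumes "\<And>x y. Q x \<Longrightarrow> Q y \<Longrightarrow> obs x = obs y \<Longrightarrow> val x = val y"
  shows "\<exists>R. \<forall>x. Q x \<longrightarrow> R (obs x) = val x"
proof (intro exI allI impI)
  fix x assume "Q x"
  then have "\<exists>y. Q y \<and> obs y = obs x" by blast
  from someI_ex[OF this] \<open>Q x\<close> show "val (SOME y. Q y \<and> obs y = obs x) = val x"
    by (intro assms) auto
qed

theorem mainTheorem3:
  assumes "CARD('n::finite) \<in> {2, 3}"
  shows "(\<exists>R :: ((real^'n) \<times> real \<Rightarrow> real) \<Rightarrow> (real^'n \<Rightarrow> real). \<forall>u a b.
            solves_wave_cauchy u a b \<and> supp a \<subseteq> ball 0 1 \<and> supp b \<subseteq> ball 0 1 \<and> b = (\<lambda>x. 0)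
              \<longrightarrow> R (observation u) = a)
       \<and> (\<exists>R :: ((real^'n) \<times> real \<Rightarrow> real) \<Rightarrow> (real^'n \<Rightarrow> real). \<forall>u a b.
            solves_wave_cauchy u a b \<and> supp a \<subseteq> ball 0 1 \<and> supp b \<subseteq> ball 0 1 \<and> a = (\<lambda>x. 0)
              \<longrightarrow> R (observation u) = b)"
proof
  let ?Q = "\<lambda>(u :: (real^'n) \<times> real \<Rightarrow> real, a, b). solves_wave_cauchy u a b \<and> supp a \<subseteq> ball 0 1 \<and> supp b \<subseteq> ball 0 1"
  \<comment> \<open>A solution and its data are packed into one triple, so that the observation and
    the sought datum are functions of the same object. Two such triples share the zero datum, as
    \<open>cauchy_data_unique\<close> requires.\<close>
  have "\<exists>R. \<forall>x. (case x of (u, a, b) \<Rightarrow> ?Q (u, a, b) \<and> b = (\<lambda>x. 0)) \<longrightarrow> R (observation (fst x)) = fst (snd x)"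
    by (rule reconstruction_exists) (auto dest: cauchy_data_unique)
  then show "\<exists>R :: ((real^'n) \<times> real \<Rightarrow> real) \<Rightarrow> (real^'n \<Rightarrow> real). \<forall>u a b.
            solves_wave_cauchy u a b \<and> supp a \<subseteq> ball 0 1 \<and> supp b \<subseteq> ball 0 1 \<and> b = (\<lambda>x. 0)
              \<longrightarrow> R (observation u) = a"
    by simp
  have "\<exists>R. \<forall>x. (case x of (u, a, b) \<Rightarrow> ?Q (u, a, b) \<and> a = (\<lambda>x. 0)) \<longrightarrow> R (observation (fst x)) = snd (snd x)"
    by (rule reconstruction_exists) (auto dest: cauchy_data_unique)
  then show "\<exists>R :: ((real^'n) \<times> real \<Rightarrow> real) \<Rightarrow> (real^'n \<Rightarrow> real). \<forall>u a b.
            solves_wave_cauchy u a b \<and> supp a \<subseteq> ball 0 1 \<and> supp b \<subseteq> ball 0 1 \<and> a = (\<lambda>x. 0)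
              \<longrightarrow> R (observation u) = b"
    by simp
qed

end
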